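(* Let $\mathbb K$ be a field, let $d$ be a nonnegative integer and let $A,A^*$ be a Leonard pair over $\mathbb K$ of diameter $d$. If $d\ge1$ then there exist exactly four $TD$-$D$ canonical forms for $A,A^*$. If $d=0$ then there exists a unique $TD$-$D$ canonical form for $A,A^*$.
   Context: $\mathrm{Mat}_{d+1}(\mathbb K)$ is the algebra of $(d+1)\times(d+1)$ matrices over $\mathbb K$, rows and columns indexed by $0,1,\dots,d$. A matrix is tridiagonal if every nonzero entry lies on the diagonal, subdiagonal or superdiagonal. Leonard pairs. Let $\mathcal A$ be a $\mathbb K$-algebra isomorphic to $\mathrm{Mat}_{d+1}(\mathbb K)$. An element $A\in\mathcal A$ is multiplicity-free if it has $d+1$ distinct eigenvalues in $\mathbb K$; if these are $\theta_0,\dots,\theta_d$, the primitive idempotent of $A$ associated with $\theta_i$ is $E_i=\prod_{j\ne i}(A-\theta_jI)/(\theta_i-\theta_j)$. For multiplicity-free $A,A^*\in\mathcal A$ ($A^*$ is just a name, not an adjoint), an idempotent sequence for $A,A^*$ is an ordering $E_0,\dots,E_d$ of the primitive idempotents of $A$ such that $E_iA^*E_j=0$ if $|i-j|>1$ and $E_iA^*E_j\ne0$ if $|i-j|=1$ ($0\le i,j\le d$); a dual idempotent sequence for $A,A^*$ is an idempotent sequence for $A^*,A$. A Leonard pair in $\mathcal A$ (with ambient algebra $\mathcal A$, over $\mathbb K$, of diameter $d$) is an ordered pair $A,A^*$ of multiplicity-free elements of $\mathcal A$ for which an idempotent sequence and a dual idempotent sequence exist. An eigenvalue sequence of a Leonard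 pair $A,A^*$ is a sequence $\theta_0,\dots,\theta_d$ where $\theta_i$ is the eigenvalue of $A$ associated with $E_i$ for some idempotent sequence $E_0,\dots,E_d$ of $A,A^*$; if $\theta_0,\dots,\theta_d$ is one, then the only other one is $\theta_d,\dots,\theta_0$. Leonard pairs $A,A^*$ and $B,B^*$ are isomorphic if there is a $\mathbb K$-algebra isomorphism between their ambient algebras sending $A$ to $B$ and $A^*$ to $B^*$. $TD$-$D$ canonical form. A Leonard pair $A,A^*$ with eigenvalue sequence $\theta_0,\dots,\theta_d$ is in $TD$-$D$ canonical form if its ambient algebra is $\mathrm{Mat}_{d+1}(\mathbb K)$, $A$ is tridiagonal and $A^*$ is diagonal, and $A$ has constant row sum (all row sums equal) with this sum equal to $\theta_0$ or $\theta_d$. A $TD$-$D$ canonical form for a Leonard pair $A,A^*$ is a Leonard pair over $\mathbb K$ which is isomorphic to $A,A^*$ and which is in $TD$-$D$ canonical form. *)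

theory Defs
  imports
    "HOL-Algebra.QuotRing"
    "Jordan_Normal_Form.Char_Poly"
    "Jordan_Normal_Form.VS_Connect"
begin

text \<open>The ground field is a type of class \<open>field\<close>. The locale \<open>algebra\<close> of HOL-Algebra is
  restricted to commutative algebras, hence the following definition of a unital associative
  algebra over the ground field.\<close>

definition assoc_algebra :: "('k::field, 'a) module \<Rightarrow> bool" where
  "assoc_algebra M \<longleftrightarrow>
     Module.module class_ring M \<and> ring M \<and>
     (\<forall>c. \<forall>x\<in>carrier M. \<forall>y\<in>carrier M.
        (c \<odot>\<^bsub>M\<^esub> x) \<otimes>\<^bsub>M\<^esub> y = c \<odot>\<^bsub>M\<^esub> (x \<otimes>\<^bsub>M\<^esub> y) \<and>
        x \<otimes>\<^bsub>M\<^esub> (c \<odot>\<^bsub>M\<^esub> y) = c \<odot>\<^bsub>M\<^esub> (x \<otimes>\<^bsub>M\<^esub> y))"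

definition algebra_iso ::
  "('k::field, 'a) module \<Rightarrow> ('k, 'b) module \<Rightarrow> ('a \<Rightarrow> 'b) set" where
  "algebra_iso M N =
     {\<phi> \<in> ring_iso M N. \<forall>c. \<forall>x\<in>carrier M. \<phi> (c \<odot>\<^bsub>M\<^esub> x) = c \<odot>\<^bsub>N\<^esub> \<phi> x}"

abbreviation mat_algebra :: "nat \<Rightarrow> ('k::field, 'k mat) module" where
  "mat_algebra d \<equiv> module_mat TYPE('k) (d + 1) (d + 1)"

text \<open>Eigenvalues of an element of an algebra isomorphic to \<open>mat_algebra d\<close> are those of the
  matrix that represents it; they do not depend on the isomorphism, since \<open>t\<close> is an eigenvalue
  of \<open>A\<close> iff \<open>A - t 1\<close> is not invertible in the algebra.\<close>

definition eigenvalues_in :: "('k::field, 'a) module \<Rightarrow> nat \<Rightarrow> 'a \<Rightarrow> 'k set" where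
  "eigenvalues_in M d A = {t. \<exists>\<phi>\<in>algebra_iso M (mat_algebra d). eigenvalue (\<phi> A) t}"

definition multiplicity_free :: "('k::field, 'a) module \<Rightarrow> nat \<Rightarrow> 'a \<Rightarrow> bool" where
  "multiplicity_free M d A \<longleftrightarrow> A \<in> carrier M \<and> card (eigenvalues_in M d A) = d + 1"

text \<open>A sequence indexed by \<open>0, \<dots>, d\<close> is a function on \<open>nat\<close>; its values beyond \<open>d\<close> are
  irrelevant. The list product below multiplies commuting factors, so its order plays no role.\<close>

definition primitive_idempotent ::
  "('k::field, 'a) module \<Rightarrow> nat \<Rightarrow> 'a \<Rightarrow> (nat \<Rightarrow> 'k) \<Rightarrow> nat \<Rightarrow> 'a" where
  "primitive_idempotent M d A \<theta> i =
     foldr (\<otimes>\<^bsub>M\<^esub>)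
       (map (\<lambda>j. (1 / (\<theta> i - \<theta> j)) \<odot>\<^bsub>M\<^esub> (A \<ominus>\<^bsub>M\<^esub> \<theta> j \<odot>\<^bsub>M\<^esub> \<one>\<^bsub>M\<^esub>))
          (filter (\<lambda>j. j \<noteq> i) [0..<d + 1]))
       \<one>\<^bsub>M\<^esub>"

definition primitive_idempotent_ordering ::
  "('k::field, 'a) module \<Rightarrow> nat \<Rightarrow> 'a \<Rightarrow> (nat \<Rightarrow> 'k) \<Rightarrow> (nat \<Rightarrow> 'a) \<Rightarrow> bool" where
  "primitive_idempotent_ordering M d A \<theta> E \<longleftrightarrow>
     bij_betw \<theta> {0..d} (eigenvalues_in M d A) \<and>
     (\<forall>i\<le>d. E i = primitive_idempotent M d A \<theta> i)"

definition idempotent_sequence ::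
  "('k::field, 'a) module \<Rightarrow> nat \<Rightarrow> 'a \<Rightarrow> 'a \<Rightarrow> (nat \<Rightarrow> 'a) \<Rightarrow> bool" where
  "idempotent_sequence M d A As E \<longleftrightarrow>
     (\<exists>\<theta>. primitive_idempotent_ordering M d A \<theta> E) \<and>
     (\<forall>i\<le>d. \<forall>j\<le>d.
        (\<bar>int i - int j\<bar> > 1 \<longrightarrow> E i \<otimes>\<^bsub>M\<^esub> As \<otimes>\<^bsub>M\<^esub> E j = \<zero>\<^bsub>M\<^esub>) \<and>
        (\<bar>int i - int j\<bar> = 1 \<longrightarrow> E i \<otimes>\<^bsub>M\<^esub> As \<otimes>\<^bsub>M\<^esub> E j \<noteq> \<zero>\<^bsub>M\<^esub>))"

definition leonard_pair :: "('k::field, 'a) module \<Rightarrow> nat \<Rightarrow> 'a \<Rightarrow> 'a \<Rightarrow> bool" where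
  "leonard_pair M d A As \<longleftrightarrow>
     assoc_algebra M \<and> algebra_iso M (mat_algebra d) \<noteq> {} \<and>
     multiplicity_free M d A \<and> multiplicity_free M d As \<and>
     (\<exists>E. idempotent_sequence M d A As E) \<and> (\<exists>Es. idempotent_sequence M d As A Es)"

definition eigenvalue_sequence ::
  "('k::field, 'a) module \<Rightarrow> nat \<Rightarrow> 'a \<Rightarrow> 'a \<Rightarrow> (nat \<Rightarrow> 'k) \<Rightarrow> bool" where
  "eigenvalue_sequence M d A As \<theta> \<longleftrightarrow>
     (\<exists>E. idempotent_sequence M d A As E \<and> primitive_idempotent_ordering M d A \<theta> E)"

definition leonard_isomorphic ::
  "('k::field, 'a) module \<Rightarrow> 'a \<Rightarrow> 'a \<Rightarrow> ('k, 'b) module \<Rightarrow> 'b \<Rightarrow> 'b \<Rightarrow> bool" where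
  "leonard_isomorphic M A As N B Bs \<longleftrightarrow> (\<exists>\<phi>\<in>algebra_iso M N. \<phi> A = B \<and> \<phi> As = Bs)"

definition tridiagonal_mat :: "'k::zero mat \<Rightarrow> bool" where
  "tridiagonal_mat A \<longleftrightarrow>
     (\<forall>i<dim_row A. \<forall>j<dim_col A. A $$ (i, j) \<noteq> 0 \<longrightarrow> \<bar>int i - int j\<bar> \<le> 1)"

definition in_TDD_canonical_form :: "nat \<Rightarrow> 'k::field mat \<Rightarrow> 'k mat \<Rightarrow> bool" where
  "in_TDD_canonical_form d B Bs \<longleftrightarrow>
     leonard_pair (mat_algebra d) d B Bs \<and> tridiagonal_mat B \<and> diagonal_mat Bs \<and>
     (\<exists>\<theta>. eigenvalue_sequence (mat_algebra d) d B Bs \<theta> \<and>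
        (\<exists>s\<in>{\<theta> 0, \<theta> d}. \<forall>i\<le>d. (\<Sum>j\<le>d. B $$ (i, j)) = s))"

definition TDD_canonical_forms ::
  "('k::field, 'a) module \<Rightarrow> 'a \<Rightarrow> 'a \<Rightarrow> ('k mat \<times> 'k mat) set" where
  "TDD_canonical_forms M A As =
     {(B, Bs). \<exists>d. in_TDD_canonical_form d B Bs \<and>
        leonard_isomorphic M A As (mat_algebra d) B Bs}"

end

theory Submission
  imports Defs
begin

text \<open>In a canonical form \<open>B, D\<close> the diagonal of \<open>D\<close> lists the eigenvalues of \<open>As\<close>. The Leonard
  property makes this list a dual eigenvalue sequence \<open>\<theta>s\<close> or its reversal, since two path orderings
  of the same graph agree up to reversal. Given \<open>D\<close>, the entries \<open>B i i\<close> and the products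
  \<open>B i j * B j i\<close> are invariants of the pair, being read off from \<open>e\<^sub>i B e\<^sub>i\<close> and
  \<open>e\<^sub>i B e\<^sub>j B e\<^sub>i\<close> with the primitive idempotents \<open>e\<^sub>i\<close> of \<open>D\<close>; together with the
  row sum \<open>\<theta> 0\<close> or \<open>\<theta> d\<close> they determine \<open>B\<close> row by row. This leaves at most \<open>2 * 2\<close> forms, and
  no description of the automorphisms of the matrix algebra is needed.

  Conversely, represent \<open>As\<close> by the diagonal matrix of \<open>\<theta>s\<close>, so that \<open>A\<close> becomes an
  irreducible tridiagonal matrix \<open>X\<close>, and let the columns of \<open>Q\<close> be eigenvectors of \<open>X\<close> for
  \<open>\<theta> 0, \<dots>, \<theta> d\<close>. The rows of \<open>Q\<close> are left eigenvectors of the irreducible tridiagonal matrix that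
  represents \<open>As\<close> in the eigenbasis of \<open>A\<close>, so their entries in column \<open>0\<close> do not vanish, and
  conjugating \<open>X\<close> by the diagonal matrix of that column makes all row sums equal to \<open>\<theta> 0\<close>.\<close>

section \<open>Transport along algebra isomorphisms\<close>

lemma assoc_algebra_mat: "assoc_algebra (mat_algebra d :: ('k::field, 'k mat) module)"
proof -
  have "vectorspace (class_ring :: 'k ring) (mat_algebra d)"
    by (rule matrix_vs)
  then have "Module.module (class_ring :: 'k ring) (mat_algebra d)"
    by (simp add: vectorspace_def)
  moreover have "ring (mat_algebra d :: ('k, 'k mat) module)"
    using abelian_group_mat[where 'a = 'k]
    by (intro ringI monoidI)
      (auto simp: module_mat_simps add_mult_distrib_mat mult_add_distrib_mat)
  ultimately show ?thesis
    by (auto simp: assoc_algebra_def module_mat_simps mult_smult_distrib)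
qed

lemma module_mat_minus:
  assumes "X \<in> carrier_mat nr nc" "Y \<in> carrier_mat nr nc"
  shows "X \<ominus>\<^bsub>module_mat TYPE('k::field) nr nc\<^esub> Y = X - Y"
proof -
  interpret abelian_group "module_mat TYPE('k) nr nc"
    by (rule abelian_group_mat)
  have "\<ominus>\<^bsub>module_mat TYPE('k) nr nc\<^esub> Y = - Y"
    using assms by (intro minus_equality) (auto simp: module_mat_simps)
  with assms show ?thesis
    by (auto simp: a_minus_def module_mat_simps)
qed

section \<open>Basic properties of algebra isomorphisms\<close>

lemma algebra_iso_closed:
  assumes "\<phi> \<in> algebra_iso M N" "x \<in> carrier M"
  shows "\<phi> x \<in> carrier N"
  using assms by (auto simp: algebra_iso_def ring_iso_memE)

lemma algebra_iso_mult:
  assumes "\<phi> \<in> algebra_iso M N" "x \<in> carrier M" "y \<in> carrier M"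
  shows "\<phi> (x \<otimes>\<^bsub>M\<^esub> y) = \<phi> x \<otimes>\<^bsub>N\<^esub> \<phi> y"
  using assms by (auto simp: algebra_iso_def ring_iso_memE)

lemma algebra_iso_one:
  assumes "\<phi> \<in> algebra_iso M N"
  shows "\<phi> \<one>\<^bsub>M\<^esub> = \<one>\<^bsub>N\<^esub>"
  using assms by (auto simp: algebra_iso_def ring_iso_memE)

lemma algebra_iso_smult:
  assumes "\<phi> \<in> algebra_iso M N" "x \<in> carrier M"
  shows "\<phi> (c \<odot>\<^bsub>M\<^esub> x) = c \<odot>\<^bsub>N\<^esub> \<phi> x"
  using assms by (auto simp: algebra_iso_def)

lemma algebra_iso_bij:
  assumes "\<phi> \<in> algebra_iso M N"
  shows "bij_betw \<phi> (carrier M) (carrier N)"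
  using assms by (auto simp: algebra_iso_def ring_iso_memE)

lemma algebra_iso_trans:
  assumes "\<phi> \<in> algebra_iso M N" "\<psi> \<in> algebra_iso N P"
  shows "\<psi> \<circ> \<phi> \<in> algebra_iso M P"
  using assms ring_iso_set_trans[of \<phi> M N \<psi> P] algebra_iso_closed[OF assms(1)]
  by (auto simp: algebra_iso_def)

lemma assoc_algebra_smult_closed:
  fixes M :: "('k::field, 'a) module"
  assumes "assoc_algebra M" "x \<in> carrier M"
  shows "c \<odot>\<^bsub>M\<^esub> x \<in> carrier M"
proof -
  interpret Module.module "class_ring :: 'k ring" M
    using assms by (simp add: assoc_algebra_def)
  show ?thesis using assms smult_closed[of c x] by simp
qed

text \<open>Every element of \<open>N\<close> has the form \<open>\<phi> x\<close>, so linearity of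
  the inverse at \<open>\<phi> x\<close> is read off from linearity of \<open>\<phi>\<close> at
  \<open>x\<close>.\<close>

lemma algebra_iso_sym:
  assumes "assoc_algebra M" "\<phi> \<in> algebra_iso M N"
  shows "inv_into (carrier M) \<phi> \<in> algebra_iso N M"
proof -
  let ?\<psi> = "inv_into (carrier M) \<phi>"
  have "?\<psi> \<in> ring_iso N M"
    using assms by (intro ring_iso_set_sym) (auto simp: algebra_iso_def assoc_algebra_def)
  moreover have "?\<psi> (c \<odot>\<^bsub>N\<^esub> y) = c \<odot>\<^bsub>M\<^esub> ?\<psi> y" if y: "y \<in> carrier N" for c y
  proof -
    from y obtain x where x: "x \<in> carrier M" "y = \<phi> x"
      using algebra_iso_bij[OF assms(2)] by (auto simp: bij_betw_def)
    have inj: "inj_on \<phi> (carrier M)"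
      using algebra_iso_bij[OF assms(2)] by (simp add: bij_betw_def)
    have "c \<odot>\<^bsub>N\<^esub> y = \<phi> (c \<odot>\<^bsub>M\<^esub> x)"
      using assms x by (simp add: algebra_iso_smult)
    then show ?thesis
      using x inj assms by (simp add: assoc_algebra_smult_closed)
  qed
  ultimately show ?thesis by (simp add: algebra_iso_def)
qed

lemma algebra_iso_inv_apply:
  assumes "\<phi> \<in> algebra_iso M N" "x \<in> carrier M"
  shows "inv_into (carrier M) \<phi> (\<phi> x) = x"
  using assms algebra_iso_bij[OF assms(1)] by (simp add: bij_betw_def)

lemma algebra_iso_ring_hom_ring:
  assumes "assoc_algebra M" "assoc_algebra N" "\<phi> \<in> algebra_iso M N"
  shows "ring_hom_ring M N \<phi>"
  using assms by (intro ring_hom_ringI2) (auto simp: assoc_algebra_def algebra_iso_def ring_iso_def)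

lemma algebra_iso_minus:
  assumes "assoc_algebra M" "assoc_algebra N" "\<phi> \<in> algebra_iso M N"
    and "x \<in> carrier M" "y \<in> carrier M"
  shows "\<phi> (x \<ominus>\<^bsub>M\<^esub> y) = \<phi> x \<ominus>\<^bsub>N\<^esub> \<phi> y"
proof -
  interpret ring_hom_ring M N \<phi>
    using assms by (intro algebra_iso_ring_hom_ring)
  show ?thesis using assms by (simp add: a_minus_def)
qed

lemma algebra_iso_zero_iff:
  assumes "assoc_algebra M" "assoc_algebra N" "\<phi> \<in> algebra_iso M N" "x \<in> carrier M"
  shows "\<phi> x = \<zero>\<^bsub>N\<^esub> \<longleftrightarrow> x = \<zero>\<^bsub>M\<^esub>"
proof -
  interpret ring_hom_ring M N \<phi>
    using assms by (intro algebra_iso_ring_hom_ring)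
  show ?thesis using assms algebra_iso_bij[OF assms(3)]
    by (metis R.zero_closed bij_betw_def hom_zero inj_on_eq_iff)
qed

section \<open>Units and eigenvalues\<close>

lemma algebra_iso_Units:
  assumes "\<phi> \<in> algebra_iso M N" "x \<in> Units M"
  shows "\<phi> x \<in> Units N"
proof -
  obtain y where y: "x \<in> carrier M" "y \<in> carrier M" "y \<otimes>\<^bsub>M\<^esub> x = \<one>\<^bsub>M\<^esub>" "x \<otimes>\<^bsub>M\<^esub> y = \<one>\<^bsub>M\<^esub>"
    using assms(2) by (auto simp: Units_def)
  have "\<phi> y \<otimes>\<^bsub>N\<^esub> \<phi> x = \<one>\<^bsub>N\<^esub>" "\<phi> x \<otimes>\<^bsub>N\<^esub> \<phi> y = \<one>\<^bsub>N\<^esub>"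
    using y algebra_iso_mult[OF assms(1)] algebra_iso_one[OF assms(1)] by metis+
  then show ?thesis
    using y algebra_iso_closed[OF assms(1)] by (auto simp: Units_def)
qed

text \<open>Both sides say that \<open>det (char_matrix X t)\<close> vanishes. The right side is
  expressed in the language of algebras alone, so isomorphisms respect it.\<close>

lemma eigenvalue_iff_not_Units:
  assumes "X \<in> carrier_mat (d + 1) (d + 1)"
  shows "eigenvalue X t \<longleftrightarrow>
    X \<ominus>\<^bsub>mat_algebra d\<^esub> t \<odot>\<^bsub>mat_algebra d\<^esub> \<one>\<^bsub>mat_algebra d\<^esub> \<notin> Units (mat_algebra d)"
proof -
  have c: "X \<ominus>\<^bsub>mat_algebra d\<^esub> t \<odot>\<^bsub>mat_algebra d\<^esub> \<one>\<^bsub>mat_algebra d\<^esub> = char_matrix X t"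
    using assms by (auto simp: module_mat_simps module_mat_minus char_matrix_def intro!: eq_matI)
  \<comment> \<open>\<open>ring_mat\<close> and \<open>module_mat\<close> share carrier, product and
    one, which makes the determinant criterion for units available.\<close>
  have "Units (mat_algebra d) = Units (ring_mat TYPE('a) (d + 1) ())"
    by (simp add: Units_def ring_mat_def module_mat_simps)
  then have "char_matrix X t \<in> Units (mat_algebra d) \<longleftrightarrow> det (char_matrix X t) \<noteq> 0"
    using assms det_non_zero_imp_unit[of "char_matrix X t" "d + 1"] unit_imp_det_non_zero
    by (metis char_matrix_closed)
  then show ?thesis
    unfolding c eigenvalue_det[OF assms] by simp
qed

lemma eigenvalue_algebra_iso:
  assumes "assoc_algebra M" "\<phi> \<in> algebra_iso M (mat_algebra d)" "A \<in> carrier M"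
  shows "eigenvalue (\<phi> A) t \<longleftrightarrow> A \<ominus>\<^bsub>M\<^esub> t \<odot>\<^bsub>M\<^esub> \<one>\<^bsub>M\<^esub> \<notin> Units M"
proof -
  interpret R: ring M using assms by (simp add: assoc_algebra_def)
  let ?x = "A \<ominus>\<^bsub>M\<^esub> t \<odot>\<^bsub>M\<^esub> \<one>\<^bsub>M\<^esub>"
  have x: "?x \<in> carrier M"
    using assms by (simp add: assoc_algebra_smult_closed)
  have "\<phi> ?x = \<phi> A \<ominus>\<^bsub>mat_algebra d\<^esub> t \<odot>\<^bsub>mat_algebra d\<^esub> \<one>\<^bsub>mat_algebra d\<^esub>"
    using assms assoc_algebra_smult_closed[OF assms(1), of "\<one>\<^bsub>M\<^esub>" t]
    by (simp only: algebra_iso_minus[OF assms(1) assoc_algebra_mat] algebra_iso_smult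
        algebra_iso_one R.one_closed)
  moreover have "?x \<in> Units M" if "\<phi> ?x \<in> Units (mat_algebra d)"
    using algebra_iso_Units[OF algebra_iso_sym[OF assms(1,2)] that]
    by (simp add: algebra_iso_inv_apply[OF assms(2) x])
  moreover have "\<phi> A \<in> carrier_mat (d + 1) (d + 1)"
    using algebra_iso_closed[OF assms(2,3)] by (simp only: module_mat_simps)
  ultimately show ?thesis
    using eigenvalue_iff_not_Units[of "\<phi> A" d t] algebra_iso_Units[OF assms(2), of ?x]
    by metis
qed

text \<open>The right side mentions neither \<open>\<phi>\<close> nor \<open>d\<close>: all
  isomorphisms yield the same eigenvalues. The absence of \<open>d\<close> is what
  \<open>diameter_unique\<close> relies on.\<close>

lemma eigenvalues_in_eq:
  assumes "assoc_algebra M" "\<phi> \<in> algebra_iso M (mat_algebra d)" "A \<in> carrier M"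
  shows "eigenvalues_in M d A = {t. A \<ominus>\<^bsub>M\<^esub> t \<odot>\<^bsub>M\<^esub> \<one>\<^bsub>M\<^esub> \<notin> Units M}"
  using assms(2) by (auto simp: eigenvalues_in_def eigenvalue_algebra_iso[OF assms(1) _ assms(3)])

text \<open>Composition with \<open>\<phi>\<close> or its inverse turns isomorphisms from
  \<open>N\<close> onto the matrix algebra into such isomorphisms from \<open>M\<close>, and
  conversely.\<close>

lemma eigenvalues_in_transport:
  assumes "assoc_algebra M" "\<phi> \<in> algebra_iso M N" "A \<in> carrier M"
  shows "eigenvalues_in N d (\<phi> A) = eigenvalues_in M d A"
proof (intro equalityI subsetI)
  fix t assume "t \<in> eigenvalues_in N d (\<phi> A)"
  then obtain \<psi> where "\<psi> \<in> algebra_iso N (mat_algebra d)" "eigenvalue (\<psi> (\<phi> A)) t"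
    by (auto simp: eigenvalues_in_def)
  then have "\<psi> \<circ> \<phi> \<in> algebra_iso M (mat_algebra d)" "eigenvalue ((\<psi> \<circ> \<phi>) A) t"
    using algebra_iso_trans[OF assms(2)] by auto
  then show "t \<in> eigenvalues_in M d A"
    unfolding eigenvalues_in_def by blast
next
  fix t assume "t \<in> eigenvalues_in M d A"
  then obtain \<psi> where "\<psi> \<in> algebra_iso M (mat_algebra d)" "eigenvalue (\<psi> A) t"
    by (auto simp: eigenvalues_in_def)
  then have "\<psi> \<circ> inv_into (carrier M) \<phi> \<in> algebra_iso N (mat_algebra d)"
    "eigenvalue ((\<psi> \<circ> inv_into (carrier M) \<phi>) (\<phi> A)) t"
    using algebra_iso_trans[OF algebra_iso_sym[OF assms(1,2)]] algebra_iso_inv_apply[OF assms(2,3)]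
    by simp_all
  then show "t \<in> eigenvalues_in N d (\<phi> A)"
    unfolding eigenvalues_in_def by blast
qed

lemma eigenvalues_in_mat_algebra:
  assumes "X \<in> carrier_mat (d + 1) (d + 1)"
  shows "eigenvalues_in (mat_algebra d) d X = {t. eigenvalue X t}"
proof -
  have "id \<in> algebra_iso (mat_algebra d) (mat_algebra d)"
    by (simp add: algebra_iso_def ring_iso_set_refl)
  from eigenvalues_in_eq[OF assoc_algebra_mat this] eigenvalue_iff_not_Units[OF assms]
  show ?thesis using assms by (simp add: module_mat_simps)
qed

text \<open>The index list becomes a parameter, so that facts about
  \<open>primitive_idempotent\<close> can be proved by induction on it.\<close>

definition idempotent_product ::
  "('k::field, 'a) module \<Rightarrow> 'a \<Rightarrow> (nat \<Rightarrow> 'k) \<Rightarrow> nat \<Rightarrow> nat list \<Rightarrow> 'a" where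
  "idempotent_product M A \<theta> i js =
     foldr (\<otimes>\<^bsub>M\<^esub>)
       (map (\<lambda>j. (1 / (\<theta> i - \<theta> j)) \<odot>\<^bsub>M\<^esub> (A \<ominus>\<^bsub>M\<^esub> \<theta> j \<odot>\<^bsub>M\<^esub> \<one>\<^bsub>M\<^esub>)) js) \<one>\<^bsub>M\<^esub>"

lemma idempotent_product_simps:
  "idempotent_product M A \<theta> i [] = \<one>\<^bsub>M\<^esub>"
  "idempotent_product M A \<theta> i (j # js) =
    ((1 / (\<theta> i - \<theta> j)) \<odot>\<^bsub>M\<^esub> (A \<ominus>\<^bsub>M\<^esub> \<theta> j \<odot>\<^bsub>M\<^esub> \<one>\<^bsub>M\<^esub>)) \<otimes>\<^bsub>M\<^esub> idempotent_product M A \<theta> i js"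
  by (simp_all add: idempotent_product_def)

lemma primitive_idempotent_eq_product:
  "primitive_idempotent M d A \<theta> i = idempotent_product M A \<theta> i (filter (\<lambda>j. j \<noteq> i) [0..<d + 1])"
  by (simp add: idempotent_product_def primitive_idempotent_def)

lemma idempotent_product_closed:
  assumes "assoc_algebra M" "A \<in> carrier M"
  shows "idempotent_product M A \<theta> i js \<in> carrier M"
proof -
  interpret R: ring M using assms by (simp add: assoc_algebra_def)
  show ?thesis
    using assms
    by (induction js) (simp_all add: idempotent_product_simps assoc_algebra_smult_closed)
qed

lemma idempotent_product_transport:
  assumes "assoc_algebra M" "assoc_algebra N" "\<phi> \<in> algebra_iso M N" "A \<in> carrier M"
  shows "\<phi> (idempotent_product M A \<theta> i js) = idempotent_product N (\<phi> A) \<theta> i js"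
proof -
  interpret R: ring M using assms by (simp add: assoc_algebra_def)
  show ?thesis
  proof (induction js)
    case Nil
    show ?case using assms by (simp add: idempotent_product_simps algebra_iso_one)
  next
    case (Cons j js)
    have 1: "\<theta> j \<odot>\<^bsub>M\<^esub> \<one>\<^bsub>M\<^esub> \<in> carrier M"
      using assms by (simp add: assoc_algebra_smult_closed)
    then have 2: "A \<ominus>\<^bsub>M\<^esub> \<theta> j \<odot>\<^bsub>M\<^esub> \<one>\<^bsub>M\<^esub> \<in> carrier M"
      using assms by simp
    show ?case
      using assms 1 2
      by (simp add: idempotent_product_simps Cons algebra_iso_mult[OF assms(3)] idempotent_product_closed
          assoc_algebra_smult_closed algebra_iso_smult[OF assms(3)]
          algebra_iso_minus[OF assms(1-3)] algebra_iso_one[OF assms(3)])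
  qed
qed

lemma primitive_idempotent_closed:
  assumes "assoc_algebra M" "A \<in> carrier M"
  shows "primitive_idempotent M d A \<theta> i \<in> carrier M"
  using assms by (simp only: primitive_idempotent_eq_product idempotent_product_closed)

lemma primitive_idempotent_transport:
  assumes "assoc_algebra M" "assoc_algebra N" "\<phi> \<in> algebra_iso M N" "A \<in> carrier M"
  shows "\<phi> (primitive_idempotent M d A \<theta> i) = primitive_idempotent N d (\<phi> A) \<theta> i"
  using assms by (simp only: primitive_idempotent_eq_product idempotent_product_transport)

text \<open>Up to index \<open>d\<close> the idempotents are determined by their eigenvalues, so
  \<open>E\<close> can be eliminated and later arguments deal with sequences of scalars.\<close>

lemma eigenvalue_sequence_iff:
  "eigenvalue_sequence M d A As \<theta> \<longleftrightarrow>
     bij_betw \<theta> {0..d} (eigenvalues_in M d A) \<and>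
     (\<forall>i\<le>d. \<forall>j\<le>d.
        (\<bar>int i - int j\<bar> > 1 \<longrightarrow>
          primitive_idempotent M d A \<theta> i \<otimes>\<^bsub>M\<^esub> As \<otimes>\<^bsub>M\<^esub> primitive_idempotent M d A \<theta> j = \<zero>\<^bsub>M\<^esub>) \<and>
        (\<bar>int i - int j\<bar> = 1 \<longrightarrow>
          primitive_idempotent M d A \<theta> i \<otimes>\<^bsub>M\<^esub> As \<otimes>\<^bsub>M\<^esub> primitive_idempotent M d A \<theta> j \<noteq> \<zero>\<^bsub>M\<^esub>))"
  (is "?l \<longleftrightarrow> ?r")
proof
  assume ?l
  then obtain E where E: "idempotent_sequence M d A As E" "primitive_idempotent_ordering M d A \<theta> E"
    by (auto simp: eigenvalue_sequence_def)
  then have "E i = primitive_idempotent M d A \<theta> i" if "i \<le> d" for i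
    using that by (simp add: primitive_idempotent_ordering_def)
  with E show ?r
    by (simp add: idempotent_sequence_def primitive_idempotent_ordering_def)
next
  assume ?r
  then have "primitive_idempotent_ordering M d A \<theta> (primitive_idempotent M d A \<theta>)"
    "idempotent_sequence M d A As (primitive_idempotent M d A \<theta>)"
    unfolding idempotent_sequence_def primitive_idempotent_ordering_def by auto
  then show ?l unfolding eigenvalue_sequence_def by blast
qed

text \<open>The scalars that witness an idempotent sequence form an eigenvalue sequence.\<close>

lemma leonard_pair_iff:
  "leonard_pair M d A As \<longleftrightarrow>
     assoc_algebra M \<and> algebra_iso M (mat_algebra d) \<noteq> {} \<and>
     multiplicity_free M d A \<and> multiplicity_free M d As \<and>
     (\<exists>\<theta>. eigenvalue_sequence M d A As \<theta>) \<and> (\<exists>\<theta>. eigenvalue_sequence M d As A \<theta>)"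
proof -
  have "\<exists>\<theta>. primitive_idempotent_ordering M d X \<theta> E" if "idempotent_sequence M d X Y E" for X Y E
    using that unfolding idempotent_sequence_def by (rule conjunct1)
  then have "(\<exists>E. idempotent_sequence M d X Y E) \<longleftrightarrow> (\<exists>\<theta>. eigenvalue_sequence M d X Y \<theta>)" for X Y
    unfolding eigenvalue_sequence_def by blast
  then show ?thesis by (simp add: leonard_pair_def)
qed

text \<open>\<open>\<phi>\<close> carries each triple product to the corresponding one in
  \<open>N\<close> and sends only zero to zero.\<close>

lemma eigenvalue_sequence_transport:
  assumes "assoc_algebra M" "assoc_algebra N" "\<phi> \<in> algebra_iso M N" "A \<in> carrier M" "As \<in> carrier M"
  shows "eigenvalue_sequence N d (\<phi> A) (\<phi> As) \<theta> \<longleftrightarrow> eigenvalue_sequence M d A As \<theta>"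
proof -
  interpret R: ring M using assms by (simp add: assoc_algebra_def)
  let ?E = "primitive_idempotent M d A \<theta>" and ?F = "primitive_idempotent N d (\<phi> A) \<theta>"
  have "?F i \<otimes>\<^bsub>N\<^esub> \<phi> As \<otimes>\<^bsub>N\<^esub> ?F j = \<phi> (?E i \<otimes>\<^bsub>M\<^esub> As \<otimes>\<^bsub>M\<^esub> ?E j)" for i j
    using assms
    by (simp add: primitive_idempotent_transport[OF assms(1-4), symmetric] algebra_iso_mult[OF assms(3)]
        primitive_idempotent_closed)
  then have "?F i \<otimes>\<^bsub>N\<^esub> \<phi> As \<otimes>\<^bsub>N\<^esub> ?F j = \<zero>\<^bsub>N\<^esub> \<longleftrightarrow> ?E i \<otimes>\<^bsub>M\<^esub> As \<otimes>\<^bsub>M\<^esub> ?E j = \<zero>\<^bsub>M\<^esub>" for i j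
    using assms by (simp add: algebra_iso_zero_iff[OF assms(1-3)] primitive_idempotent_closed)
  then show ?thesis
    unfolding eigenvalue_sequence_iff eigenvalues_in_transport[OF assms(1,3,4)] by simp
qed

lemma leonard_pair_transport:
  assumes "assoc_algebra N" "\<phi> \<in> algebra_iso M N" "leonard_pair M d A As"
  shows "leonard_pair N d (\<phi> A) (\<phi> As)"
proof -
  have M: "assoc_algebra M" and A: "A \<in> carrier M" "As \<in> carrier M"
    using assms(3) by (auto simp: leonard_pair_def multiplicity_free_def)
  obtain \<psi> where "\<psi> \<in> algebra_iso M (mat_algebra d)"
    using assms(3) by (auto simp: leonard_pair_def)
  then have "\<psi> \<circ> inv_into (carrier M) \<phi> \<in> algebra_iso N (mat_algebra d)"
    using algebra_iso_trans[OF algebra_iso_sym[OF M assms(2)]] by blast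
  then have "algebra_iso N (mat_algebra d) \<noteq> {}"
    by blast
  then show ?thesis
    using assms(1,3) A algebra_iso_closed[OF assms(2)]
    by (simp add: leonard_pair_iff multiplicity_free_def eigenvalues_in_transport[OF M assms(2)]
        eigenvalue_sequence_transport[OF M assms(1,2)])
qed

text \<open>Required because \<open>TDD_canonical_forms\<close> quantifies the diameter
  existentially. Both diameters are one less than the size of the same set of eigenvalues.\<close>

lemma diameter_unique:
  assumes "leonard_pair M d A As" "leonard_pair M d' A As"
  shows "d = d'"
proof -
  have M: "assoc_algebra M" "A \<in> carrier M"
    and c: "card (eigenvalues_in M d A) = d + 1"
    using assms(1) by (simp_all add: leonard_pair_def multiplicity_free_def)
  have c': "card (eigenvalues_in M d' A) = d' + 1"
    using assms(2) by (simp add: leonard_pair_def multiplicity_free_def)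
  obtain \<phi> where \<phi>: "\<phi> \<in> algebra_iso M (mat_algebra d)"
    using assms(1) unfolding leonard_pair_def by blast
  obtain \<psi> where \<psi>: "\<psi> \<in> algebra_iso M (mat_algebra d')"
    using assms(2) unfolding leonard_pair_def by blast
  have "eigenvalues_in M d A = eigenvalues_in M d' A"
    using eigenvalues_in_eq[OF M(1) \<phi> M(2)] eigenvalues_in_eq[OF M(1) \<psi> M(2)] by (rule trans[OF _ sym])
  then have "d + 1 = d' + 1"
    using c c' by (simp only:)
  then show ?thesis by (rule add_right_imp_eq)
qed

section \<open>Diagonal matrices and irreducible tridiagonal matrices\<close>

text \<open>Stated for functions of two indices rather than matrices, so that reindexing by a
  permutation is plain composition.\<close>

definition irreducible_tridiagonal :: "nat \<Rightarrow> (nat \<Rightarrow> nat \<Rightarrow> 'k::zero) \<Rightarrow> bool" where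
  "irreducible_tridiagonal d X \<longleftrightarrow>
     (\<forall>i\<le>d. \<forall>j\<le>d. (\<bar>int i - int j\<bar> > 1 \<longrightarrow> X i j = 0) \<and> (\<bar>int i - int j\<bar> = 1 \<longrightarrow> X i j \<noteq> 0))"

text \<open>Injectivity forbids turning back, so all steps equal the first one, \<open>1\<close> or
  \<open>-1\<close>; the range then forces the start to be \<open>0\<close> or
  \<open>d\<close>.\<close>

lemma path_permutation:
  fixes \<pi> :: "nat \<Rightarrow> nat"
  assumes inj: "inj_on \<pi> {0..d}" and range: "\<pi> ` {0..d} \<subseteq> {0..d}"
    and step: "\<And>i. i < d \<Longrightarrow> \<bar>int (\<pi> (Suc i)) - int (\<pi> i)\<bar> = 1"
  shows "(\<forall>i\<le>d. \<pi> i = i) \<or> (\<forall>i\<le>d. \<pi> i = d - i)"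
proof -
  \<comment> \<open>For \<open>d = 0\<close> the value \<open>\<pi> 1\<close> is arbitrary, but then
    \<open>e\<close> is only multiplied by zero.\<close>
  define e where "e = int (\<pi> 1) - int (\<pi> 0)"
  have const: "int (\<pi> (Suc i)) = int (\<pi> i) + e" if "i < d" for i
    using that
  proof (induction i)
    case 0
    then show ?case by (simp add: e_def)
  next
    case (Suc i)
    \<comment> \<open>Opposite consecutive steps would make these two values equal.\<close>
    have "\<pi> (Suc (Suc i)) \<noteq> \<pi> i"
      using Suc.prems inj_onD[OF inj, of "Suc (Suc i)" i] by auto
    then show ?case
      using Suc step[of i] step[of "Suc i"] by force
  qed
  have lin: "int (\<pi> i) = int (\<pi> 0) + int i * e" if "i \<le> d" for i
    using that
  proof (induction i)
    case (Suc i)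
    then show ?case using const[of i] by (simp add: algebra_simps)
  qed simp
  have le: "\<pi> i \<le> d" if "i \<le> d" for i
    using range that by (simp add: image_subset_iff)
  have "e = 1 \<or> e = -1" if "d > 0"
    using step[of 0] that by (simp add: e_def) linarith
  then consider "d = 0" | "d > 0" "e = 1" | "d > 0" "e = -1"
    by blast
  then show ?thesis
  proof cases
    case 1
    then show ?thesis using le[of 0] by simp
  next
    case 2
    then have "\<pi> 0 = 0" using lin[of d] le[of d] by simp
    then show ?thesis using 2 lin by simp
  next
    case 3
    then have "\<pi> 0 = d" using lin[of d] le[of 0] by simp
    then have "int (\<pi> i) = int d - int i" if "i \<le> d" for i
      using 3 lin that by simp
    then have "\<pi> i = d - i" if "i \<le> d" for i
      using that by fastforce
    then show ?thesis by blast
  qed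
qed

text \<open>A nonzero subdiagonal entry of the permuted matrix must lie in the band of
  \<open>X\<close>, so \<open>\<pi>\<close> moves by exactly one at each step.\<close>

lemma irreducible_tridiagonal_permutation:
  assumes \<pi>: "bij_betw \<pi> {0..d} {0..d}"
    and tri: "\<And>i j. i \<le> d \<Longrightarrow> j \<le> d \<Longrightarrow> \<bar>int i - int j\<bar> > 1 \<Longrightarrow> X i j = 0"
    and irr: "irreducible_tridiagonal d (\<lambda>i j. X (\<pi> i) (\<pi> j))"
  shows "(\<forall>i\<le>d. \<pi> i = i) \<or> (\<forall>i\<le>d. \<pi> i = d - i)"
proof (rule path_permutation)
  show inj: "inj_on \<pi> {0..d}" "\<pi> ` {0..d} \<subseteq> {0..d}"
    using \<pi> by (auto simp: bij_betw_def)
  fix i assume i: "i < d"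
  then have "X (\<pi> (Suc i)) (\<pi> i) \<noteq> 0"
    using irr by (simp add: irreducible_tridiagonal_def)
  moreover have "\<pi> (Suc i) \<le> d" "\<pi> i \<le> d"
    using inj(2) i by (simp_all add: image_subset_iff)
  ultimately have "\<not> \<bar>int (\<pi> (Suc i)) - int (\<pi> i)\<bar> > 1"
    using tri by blast
  moreover have "\<pi> (Suc i) \<noteq> \<pi> i"
    using inj_onD[OF inj(1), of "Suc i" i] i by auto
  ultimately show "\<bar>int (\<pi> (Suc i)) - int (\<pi> i)\<bar> = 1"
    by linarith
qed

lemma irreducible_tridiagonal_reverse:
  "irreducible_tridiagonal d X \<Longrightarrow> irreducible_tridiagonal d (\<lambda>i j. X (d - i) (d - j))"
  by (auto simp: irreducible_tridiagonal_def of_nat_diff abs_minus_commute)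

section \<open>Diagonal matrices and their idempotents\<close>

lemma mat_diag_index:
  "i < n \<Longrightarrow> j < n \<Longrightarrow> mat_diag n f $$ (i, j) = (if i = j then f i else 0)"
  by (simp add: mat_diag_def)

lemma mat_diag_eq_iff: "mat_diag n f = mat_diag n g \<longleftrightarrow> (\<forall>i<n. f i = g i)"
proof
  assume eq: "mat_diag n f = mat_diag n g"
  have "f i = g i" if "i < n" for i
    using arg_cong[OF eq, of "\<lambda>X. X $$ (i, i)"] that by (simp add: mat_diag_index)
  then show "\<forall>i<n. f i = g i" by blast
qed (auto simp: mat_diag_def intro!: eq_matI)

text \<open>Diagonal matrices multiply entrywise, so each diagonal entry is a Lagrange product
  evaluated at \<open>\<delta> k\<close>.\<close>

lemma idempotent_product_mat_diag:
  "idempotent_product (mat_algebra d) (mat_diag (d + 1) \<delta>) \<theta> i js =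
    mat_diag (d + 1) (\<lambda>k. \<Prod>j\<leftarrow>js. (\<delta> k - \<theta> j) / (\<theta> i - \<theta> j))"
proof (induction js)
  case Nil
  show ?case by (simp add: idempotent_product_simps module_mat_simps)
next
  case (Cons j js)
  have "c \<cdot>\<^sub>m (mat_diag n \<delta> - t \<cdot>\<^sub>m 1\<^sub>m n) = mat_diag n (\<lambda>k. (\<delta> k - t) * c)" for c t n
    by (auto simp: mat_diag_def algebra_simps intro!: eq_matI)
  then show ?case
    by (simp add: idempotent_product_simps module_mat_simps module_mat_minus Cons[simplified])
qed

text \<open>The right-hand side depends on \<open>\<theta> i\<close> only: reordering the eigenvalues reorders the
  idempotents.\<close>

lemma primitive_idempotent_mat_diag:
  assumes "inj_on \<theta> {0..d}" "\<delta> ` {0..d} \<subseteq> \<theta> ` {0..d}" "i \<le> d"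
  shows "primitive_idempotent (mat_algebra d) d (mat_diag (d + 1) \<delta>) \<theta> i =
    mat_diag (d + 1) (\<lambda>k. if \<delta> k = \<theta> i then 1 else 0)"
  unfolding primitive_idempotent_eq_product idempotent_product_mat_diag mat_diag_eq_iff
proof (intro allI impI)
  fix k assume k: "k < d + 1"
  let ?js = "filter (\<lambda>j. j \<noteq> i) [0..<d + 1]"
  have js: "set ?js = {0..d} - {i}"
    by (auto simp del: upt_Suc)
  have ne: "\<theta> i \<noteq> \<theta> j" if "j \<in> set ?js" for j
    using that assms(1,3) unfolding js by (auto simp: inj_on_def)
  show "(\<Prod>j\<leftarrow>?js. (\<delta> k - \<theta> j) / (\<theta> i - \<theta> j)) = (if \<delta> k = \<theta> i then 1 else 0)"
  proof (cases "\<delta> k = \<theta> i")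
    case True
    have "map (\<lambda>j. (\<delta> k - \<theta> j) / (\<theta> i - \<theta> j)) ?js = map (\<lambda>j. 1) ?js"
      using ne True by (intro map_cong) auto
    then show ?thesis
      using True by (simp add: map_replicate_const)
  next
    case False
    \<comment> \<open>\<open>\<delta> k\<close> equals some \<open>\<theta> j\<close> with
      \<open>j\<close> different from \<open>i\<close>, and the factor of that \<open>j\<close> is
      zero.\<close>
    have "\<delta> k \<in> \<theta> ` {0..d}"
      using assms(2) k by (simp add: image_subset_iff)
    then obtain j where j: "j \<le> d" "\<delta> k = \<theta> j"
      by auto
    with False have "0 \<in> set (map (\<lambda>j. (\<delta> k - \<theta> j) / (\<theta> i - \<theta> j)) ?js)"
      unfolding set_map js by (intro image_eqI[of _ _ j]) auto
    then show ?thesis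
      using False by (simp only: prod_list_zero_iff if_False)
  qed
qed

lemma eigenvalue_mat_diag:
  fixes \<delta> :: "nat \<Rightarrow> 'k::field"
  shows "eigenvalue (mat_diag (d + 1) \<delta>) t \<longleftrightarrow> t \<in> \<delta> ` {0..d}"
proof -
  have "upper_triangular (mat_diag (d + 1) \<delta>)"
    by (auto simp: mat_diag_def upper_triangular_def)
  then have "eigenvalue (mat_diag (d + 1) \<delta>) t \<longleftrightarrow>
      0 \<in> set (map (\<lambda>a. poly [:- a, 1:] t) (diag_mat (mat_diag (d + 1) \<delta>)))"
    by (simp add: eigenvalue_root_char_poly[OF mat_diag_dim] char_poly_upper_triangular[OF mat_diag_dim]
        poly_prod_list prod_list_zero_iff o_def del: upt_Suc)
  also have "\<dots> \<longleftrightarrow> t \<in> set (diag_mat (mat_diag (d + 1) \<delta>))"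
    by auto
  also have "set (diag_mat (mat_diag (d + 1) \<delta>)) = \<delta> ` {0..d}"
    by (auto simp: diag_mat_def mat_diag_def atLeast0LessThan atLeast0AtMost lessThan_Suc_atMost
        simp del: upt_Suc)
  finally show ?thesis .
qed

lemma eigenvalues_in_mat_diag:
  "eigenvalues_in (mat_algebra d) d (mat_diag (d + 1) \<delta>) = \<delta> ` {0..d}"
  unfolding eigenvalues_in_mat_algebra[OF mat_diag_dim] eigenvalue_mat_diag by simp

lemma mat_diag_mult_mat_mult_mat_diag:
  assumes "X \<in> carrier_mat n n"
  shows "mat_diag n f * X * mat_diag n g = Matrix.mat n n (\<lambda>(i, j). f i * X $$ (i, j) * g j)"
  using assms
  by (subst mat_diag_mult_right[of _ n])
    (auto simp: mat_diag_mult_left[of _ n n] intro!: eq_matI)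

text \<open>\<open>\<pi>\<close> translates the order of \<theta> into positions on the diagonal.
  The idempotent for \<open>\<theta> i\<close> is the diagonal matrix unit at
  \<open>\<pi> i\<close>, so a triple product keeps just the entry of \<open>X\<close> at
  \<open>(\<pi> i, \<pi> j)\<close>.\<close>

lemma eigenvalue_sequence_mat_diag:
  assumes X: "X \<in> carrier_mat (d + 1) (d + 1)" and \<delta>: "inj_on \<delta> {0..d}"
    and \<pi>: "bij_betw \<pi> {0..d} {0..d}" and \<theta>: "\<And>i. i \<le> d \<Longrightarrow> \<theta> i = \<delta> (\<pi> i)"
  shows "eigenvalue_sequence (mat_algebra d) d (mat_diag (d + 1) \<delta>) X \<theta> \<longleftrightarrow>
    irreducible_tridiagonal d (\<lambda>i j. X $$ (\<pi> i, \<pi> j))"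
proof -
  have bij: "bij_betw \<theta> {0..d} (\<delta> ` {0..d})"
    using bij_betw_trans[OF \<pi> inj_on_imp_bij_betw[OF \<delta>]] \<theta>
    by (subst bij_betw_cong[of _ _ "\<delta> \<circ> \<pi>"]) auto
  have le: "\<pi> i \<le> d" if "i \<le> d" for i
    using \<pi> that by (auto simp: bij_betw_def)
  let ?E = "primitive_idempotent (mat_algebra d) d (mat_diag (d + 1) \<delta>) \<theta>"
  have E: "?E i = mat_diag (d + 1) (\<lambda>k. if k = \<pi> i then 1 else 0)" if "i \<le> d" for i
  proof -
    have "?E i = mat_diag (d + 1) (\<lambda>k. if \<delta> k = \<theta> i then 1 else 0)"
      using bij that by (intro primitive_idempotent_mat_diag) (auto simp: bij_betw_def)
    also have "\<dots> = mat_diag (d + 1) (\<lambda>k. if k = \<pi> i then 1 else 0)"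
      using \<delta> le[OF that] that by (auto simp: mat_diag_eq_iff \<theta> inj_on_def)
    finally show ?thesis .
  qed
  have EXE: "?E i * X * ?E j = 0\<^sub>m (d + 1) (d + 1) \<longleftrightarrow> X $$ (\<pi> i, \<pi> j) = 0"
    if ij: "i \<le> d" "j \<le> d" for i j
  proof -
    have eq: "?E i * X * ?E j =
        Matrix.mat (d + 1) (d + 1) (\<lambda>(k, l). if k = \<pi> i \<and> l = \<pi> j then X $$ (\<pi> i, \<pi> j) else 0)"
      unfolding E[OF ij(1)] E[OF ij(2)] mat_diag_mult_mat_mult_mat_diag[OF X]
      by (auto intro!: eq_matI)
    show ?thesis
    proof
      assume "?E i * X * ?E j = 0\<^sub>m (d + 1) (d + 1)"
      from arg_cong[OF this, of "\<lambda>Y. Y $$ (\<pi> i, \<pi> j)"] show "X $$ (\<pi> i, \<pi> j) = 0"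
        using le[OF ij(1)] le[OF ij(2)] unfolding eq by simp
    next
      assume "X $$ (\<pi> i, \<pi> j) = 0"
      then show "?E i * X * ?E j = 0\<^sub>m (d + 1) (d + 1)"
        unfolding eq by (auto intro!: eq_matI)
    qed
  qed
  show ?thesis
    using bij EXE
    unfolding eigenvalue_sequence_iff eigenvalues_in_mat_diag irreducible_tridiagonal_def
      module_mat_simps by auto
qed

section \<open>Diagonalization\<close>

text \<open>The inverse map sends \<open>X\<close> to \<open>Q * X * P\<close>. Such isomorphisms
  serve to pass to an eigenbasis and to rescale basis vectors.\<close>

lemma conjugation_algebra_iso:
  fixes P Q :: "'k::field mat"
  assumes P: "P \<in> carrier_mat (d + 1) (d + 1)" and Q: "Q \<in> carrier_mat (d + 1) (d + 1)"
    and PQ: "P * Q = 1\<^sub>m (d + 1)"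
  shows "(\<lambda>X. P * X * Q) \<in> algebra_iso (mat_algebra d) (mat_algebra d)"
proof -
  let ?n = "d + 1"
  have QP: "Q * P = 1\<^sub>m ?n"
    using mat_mult_left_right_inverse[OF P Q PQ] .
  note [simp] = assoc_mult_mat[of _ ?n ?n _ ?n _ ?n]
  have cancel: "Q * (P * X) = X" "P * (Q * X) = X" if "X \<in> carrier_mat ?n ?n" for X
    using assoc_mult_mat[OF Q P that] assoc_mult_mat[OF P Q that] PQ QP that by simp_all
  have bij: "bij_betw (\<lambda>X. P * X * Q) (carrier_mat ?n ?n) (carrier_mat ?n ?n)"
    using P Q PQ QP cancel by (intro bij_betw_byWitness[where f' = "\<lambda>X. Q * X * P"]) auto
  have "(\<lambda>X. P * X * Q) \<in> ring_iso (mat_algebra d) (mat_algebra d)"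
  proof (rule ring_iso_memI)
    show "bij_betw (\<lambda>X. P * X * Q) (carrier (mat_algebra d)) (carrier (mat_algebra d))"
      using bij by (simp only: module_mat_simps)
  next
    fix X Y :: "'k mat" assume XY: "X \<in> carrier (mat_algebra d)" "Y \<in> carrier (mat_algebra d)"
    then show "P * (X \<otimes>\<^bsub>mat_algebra d\<^esub> Y) * Q =
        (P * X * Q) \<otimes>\<^bsub>mat_algebra d\<^esub> (P * Y * Q)"
      using P Q cancel by (auto simp: module_mat_simps)
    show "P * (X \<oplus>\<^bsub>mat_algebra d\<^esub> Y) * Q =
        (P * X * Q) \<oplus>\<^bsub>mat_algebra d\<^esub> (P * Y * Q)"
      using P Q XY
      by (auto simp: module_mat_simps mult_add_distrib_mat[of _ ?n ?n _ ?n]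
          add_mult_distrib_mat[of _ ?n ?n _ _ ?n])
  qed (use P Q PQ in \<open>auto simp: module_mat_simps\<close>)
  then show ?thesis
    using P Q
    by (auto simp: algebra_iso_def module_mat_simps mult_smult_distrib[of _ ?n ?n _ ?n]
        mult_smult_assoc_mat[of _ ?n ?n _ ?n])
qed

text \<open>The relation \<open>X * Q = Q * D\<close> passes to each linear factor and hence to
  products. It is kept in this inverse-free form because it serves to prove that a matrix of
  eigenvectors is invertible.\<close>

lemma idempotent_product_intertwine:
  fixes X D Q :: "'k::field mat"
  assumes X: "X \<in> carrier_mat (d + 1) (d + 1)" and D: "D \<in> carrier_mat (d + 1) (d + 1)"
    and Q: "Q \<in> carrier_mat (d + 1) (d + 1)" and XQ: "X * Q = Q * D"
  shows "idempotent_product (mat_algebra d) X \<theta> i js * Q =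
    Q * idempotent_product (mat_algebra d) D \<theta> i js"
proof (induction js)
  case Nil
  show ?case using Q by (simp add: idempotent_product_simps module_mat_simps)
next
  case (Cons j js)
  let ?n = "d + 1" and ?c = "1 / (\<theta> i - \<theta> j)"
  let ?p = "\<lambda>X. idempotent_product (mat_algebra d) X \<theta> i js"
  let ?l = "\<lambda>X. ?c \<cdot>\<^sub>m (X - \<theta> j \<cdot>\<^sub>m 1\<^sub>m ?n)"
  have p: "?p Y \<in> carrier_mat ?n ?n" if "Y \<in> carrier_mat ?n ?n" for Y
    using idempotent_product_closed[OF assoc_algebra_mat, of Y d] that by (simp add: module_mat_simps)
  have step: "idempotent_product (mat_algebra d) Y \<theta> i (j # js) = ?l Y * ?p Y"
    if "Y \<in> carrier_mat ?n ?n" for Y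
    using that by (simp add: idempotent_product_simps module_mat_simps module_mat_minus)
  have sub: "Y - \<theta> j \<cdot>\<^sub>m 1\<^sub>m ?n \<in> carrier_mat ?n ?n" for Y
    by (simp add: minus_carrier_mat)
  have "(X - \<theta> j \<cdot>\<^sub>m 1\<^sub>m ?n) * Q = Q * (D - \<theta> j \<cdot>\<^sub>m 1\<^sub>m ?n)"
    using X D Q XQ
    by (simp add: minus_mult_distrib_mat[of _ ?n ?n _ _ ?n] mult_minus_distrib_mat[of _ ?n ?n _ ?n]
        mult_smult_distrib[of _ ?n ?n _ ?n] mult_smult_assoc_mat[of _ ?n ?n _ ?n])
  then have l: "?l X * Q = Q * ?l D"
    using mult_smult_assoc_mat[OF sub Q] mult_smult_distrib[OF Q sub] by simp
  have "?l X * ?p X * Q = ?l X * (?p X * Q)"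
    using X Q p[OF X] by (intro assoc_mult_mat[of _ ?n ?n _ ?n _ ?n]) auto
  also have "\<dots> = ?l X * Q * ?p D"
    unfolding Cons using X Q p[OF D] by (intro assoc_mult_mat[of _ ?n ?n _ ?n _ ?n, symmetric]) auto
  also have "\<dots> = Q * (?l D * ?p D)"
    unfolding l using Q D p[OF D] by (intro assoc_mult_mat[of _ ?n ?n _ ?n _ ?n]) auto
  finally show ?case
    unfolding step[OF X] step[OF D] .
qed

section \<open>Matrices of eigenvectors\<close>

lemma mult_mat_vec_index_sum:
  assumes "X \<in> carrier_mat n m" "v \<in> carrier_vec m" "i < n"
  shows "(X *\<^sub>v v) $ i = (\<Sum>k<m. X $$ (i, k) * v $ k)"
  using assms by (auto simp: scalar_prod_def atLeast0LessThan intro!: sum.cong)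

lemma mult_mat_index_sum:
  assumes "X \<in> carrier_mat n m" "Y \<in> carrier_mat m l" "i < n" "j < l"
  shows "(X * Y) $$ (i, j) = (\<Sum>k<m. X $$ (i, k) * Y $$ (k, j))"
  using assms by (auto simp: scalar_prod_def atLeast0LessThan intro!: sum.cong)

text \<open>The columns of \<open>Q\<close> are eigenvectors. Applied to a relation between them
  with coefficients \<open>c\<close>, the idempotent of \<open>X\<close> for
  \<open>\<theta> i\<close> leaves only column \<open>i\<close> times \<open>c $ i\<close>; hence
  they are independent.\<close>

lemma diagonalization:
  fixes X :: "'k::field mat"
  assumes X: "X \<in> carrier_mat (d + 1) (d + 1)" and inj: "inj_on \<theta> {0..d}"
    and ev: "\<And>i. i \<le> d \<Longrightarrow> eigenvalue X (\<theta> i)"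
  obtains P Q where "P \<in> carrier_mat (d + 1) (d + 1)" "Q \<in> carrier_mat (d + 1) (d + 1)"
    "P * Q = 1\<^sub>m (d + 1)" "X * Q = Q * mat_diag (d + 1) \<theta>"
proof -
  let ?n = "d + 1" and ?D = "mat_diag (d + 1) \<theta>"
  have "\<forall>i. \<exists>v. i \<le> d \<longrightarrow> eigenvector X v (\<theta> i)"
    using ev by (auto simp: eigenvalue_def)
  then obtain v where v: "\<And>i. i \<le> d \<Longrightarrow> eigenvector X (v i) (\<theta> i)"
    by metis
  have vc: "v i \<in> carrier_vec ?n" and v0: "v i \<noteq> 0\<^sub>v ?n" and Xv: "X *\<^sub>v v i = \<theta> i \<cdot>\<^sub>v v i"
    if "i \<le> d" for i
    using v[OF that] X by (auto simp: eigenvector_def)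
  define Q where "Q = Matrix.mat ?n ?n (\<lambda>(i, j). v j $ i)"
  have Q: "Q \<in> carrier_mat ?n ?n"
    by (simp add: Q_def)
  have XQ: "X * Q = Q * ?D"
  proof (rule eq_matI)
    fix i j assume "i < dim_row (Q * ?D)" "j < dim_col (Q * ?D)"
    then have ij: "i < ?n" "j < ?n"
      using Q by (auto simp: mat_diag_def)
    have "(X * Q) $$ (i, j) = (\<Sum>k<?n. X $$ (i, k) * v j $ k)"
      unfolding mult_mat_index_sum[OF X Q ij] by (intro sum.cong) (use ij in \<open>auto simp: Q_def\<close>)
    also have "\<dots> = (X *\<^sub>v v j) $ i"
      using X vc[of j] ij by (subst mult_mat_vec_index_sum) auto
    also have "\<dots> = \<theta> j * v j $ i"
      using Xv[of j] vc[of j] ij by simp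
    also have "\<dots> = (Q * ?D) $$ (i, j)"
      unfolding mat_diag_mult_right[OF Q] using ij by (simp add: Q_def)
    finally show "(X * Q) $$ (i, j) = (Q * ?D) $$ (i, j)" .
  qed (use X Q in \<open>auto simp: mat_diag_def\<close>)
  have "det Q \<noteq> 0"
  proof
    assume "det Q = 0"
    then obtain c where c: "c \<in> carrier_vec ?n" "c \<noteq> 0\<^sub>v ?n" "Q *\<^sub>v c = 0\<^sub>v ?n"
      using det_0_iff_vec_prod_zero_field[OF Q] by blast
    have "c $ i = 0" if i: "i < ?n" for i
    proof -
      have id: "i \<le> d" using i by simp
      let ?p = "\<lambda>X. primitive_idempotent (mat_algebra d) d X \<theta> i"
      have pc: "?p X \<in> carrier_mat ?n ?n"
        using primitive_idempotent_closed[OF assoc_algebra_mat, of X d] X by (simp add: module_mat_simps)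
      have "?p ?D = mat_diag ?n (\<lambda>k. if \<theta> k = \<theta> i then 1 else 0)"
        using inj id by (intro primitive_idempotent_mat_diag) auto
      also have "\<dots> = mat_diag ?n (\<lambda>k. if k = i then 1 else 0)"
        using inj id by (auto simp: mat_diag_eq_iff inj_on_def)
      finally have pD: "?p ?D = mat_diag ?n (\<lambda>k. if k = i then 1 else 0)" .
      \<comment> \<open>The idempotent of the diagonal matrix moves past \<open>Q\<close> and
        becomes that of \<open>X\<close>, which is then applied to the zero vector
        \<open>Q *\<^sub>v c\<close>.\<close>
      have "(Q * ?p ?D) *\<^sub>v c = (?p X * Q) *\<^sub>v c"
        unfolding primitive_idempotent_eq_product
        using idempotent_product_intertwine[OF X mat_diag_dim Q XQ] by simp
      also have "\<dots> = 0\<^sub>v ?n"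
        using c pc Q by (subst assoc_mult_mat_vec[of _ ?n ?n _ ?n]) auto
      finally have zero: "(Q * ?p ?D) *\<^sub>v c = 0\<^sub>v ?n" .
      \<comment> \<open>A nonzero coordinate of the eigenvector, from which \<open>c $ i = 0\<close>
        can be read off.\<close>
      obtain k where k: "k < ?n" "v i $ k \<noteq> 0"
        using v0[OF id] vc[OF id] by (metis carrier_vecD eq_vecI index_zero_vec)
      have "((Q * ?p ?D) *\<^sub>v c) $ k = (\<Sum>l<?n. (Q * ?p ?D) $$ (k, l) * c $ l)"
        using Q c k unfolding pD by (intro mult_mat_vec_index_sum) auto
      also have "\<dots> = (\<Sum>l<?n. if l = i then v i $ k * c $ i else 0)"
        unfolding pD mat_diag_mult_right[OF Q] using k by (intro sum.cong) (auto simp: Q_def)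
      also have "\<dots> = v i $ k * c $ i"
        using i by (simp del: sum.lessThan_Suc)
      finally show ?thesis
        using k zero by simp
    qed
    then show False
      using c(1,2) by (metis carrier_vecD eq_vecI index_zero_vec)
  qed
  from det_non_zero_imp_unit[OF Q this, of "()"] obtain P
    where "P \<in> carrier_mat ?n ?n" "P * Q = 1\<^sub>m ?n"
    by (auto simp: Units_def ring_mat_def)
  with that Q XQ show ?thesis by blast
qed

text \<open>\<open>P\<close> and \<open>Q\<close> stay visible because the existence proof works
  with the rows and the first column of \<open>Q\<close>; elsewhere
  \<open>diagonal_representation\<close> suffices.\<close>

lemma diagonalizing_iso:
  fixes M :: "('k::field, 'a) module"
  assumes M: "assoc_algebra M" and \<phi>: "\<phi> \<in> algebra_iso M (mat_algebra d)" and A: "A \<in> carrier M"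
    and bij: "bij_betw \<theta> {0..d} (eigenvalues_in M d A)"
  obtains P Q where "P \<in> carrier_mat (d + 1) (d + 1)" "Q \<in> carrier_mat (d + 1) (d + 1)"
    "P * Q = 1\<^sub>m (d + 1)" "\<phi> A * Q = Q * mat_diag (d + 1) \<theta>"
    "(\<lambda>X. P * X * Q) \<circ> \<phi> \<in> algebra_iso M (mat_algebra d)"
    "P * \<phi> A * Q = mat_diag (d + 1) \<theta>"
proof -
  have X: "\<phi> A \<in> carrier_mat (d + 1) (d + 1)"
    using algebra_iso_closed[OF \<phi> A] by (simp only: module_mat_simps)
  have "eigenvalue (\<phi> A) (\<theta> i)" if "i \<le> d" for i
    using bij that eigenvalues_in_transport[OF M \<phi> A] eigenvalues_in_mat_algebra[OF X]
    by (auto simp: bij_betw_def)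
  then obtain P Q where PQ: "P \<in> carrier_mat (d + 1) (d + 1)" "Q \<in> carrier_mat (d + 1) (d + 1)"
    "P * Q = 1\<^sub>m (d + 1)" "\<phi> A * Q = Q * mat_diag (d + 1) \<theta>"
    using diagonalization[OF X] bij by (metis bij_betw_def)
  have "P * \<phi> A * Q = P * (Q * mat_diag (d + 1) \<theta>)"
    using PQ X by (subst assoc_mult_mat[of _ "d + 1" "d + 1" _ "d + 1" _ "d + 1"]) auto
  also have "\<dots> = mat_diag (d + 1) \<theta>"
    using PQ by (subst assoc_mult_mat[of _ "d + 1" "d + 1" _ "d + 1" _ "d + 1", symmetric])
      (auto simp: left_mult_one_mat[OF mat_diag_dim])
  finally show ?thesis
    using that[OF PQ] algebra_iso_trans[OF \<phi> conjugation_algebra_iso[OF PQ(1-3)]] by blast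
qed

lemma diagonal_representation:
  fixes M :: "('k::field, 'a) module"
  assumes "assoc_algebra M" "\<phi> \<in> algebra_iso M (mat_algebra d)" "A \<in> carrier M"
    "bij_betw \<theta> {0..d} (eigenvalues_in M d A)"
  obtains \<psi> where "\<psi> \<in> algebra_iso M (mat_algebra d)" "\<psi> A = mat_diag (d + 1) \<theta>"
proof -
  obtain P Q where "(\<lambda>X. P * X * Q) \<circ> \<phi> \<in> algebra_iso M (mat_algebra d)"
    "P * \<phi> A * Q = mat_diag (d + 1) \<theta>"
    by (rule diagonalizing_iso[OF assms])
  then show ?thesis
    by (intro that[of "(\<lambda>X. P * X * Q) \<circ> \<phi>"]) simp_all
qed

section \<open>Existence of canonical forms\<close>

text \<open>The sequence \<theta> and the diagonal \<delta> list the same \<open>d + 1\<close>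
  distinct eigenvalues, so they differ by a permutation of the positions.\<close>

lemma eigenvalue_sequence_permutation:
  fixes M :: "('k::field, 'a) module"
  assumes M: "assoc_algebra M" and \<psi>: "\<psi> \<in> algebra_iso M (mat_algebra d)"
    and A: "A \<in> carrier M" "As \<in> carrier M"
    and diag: "\<psi> A = mat_diag (d + 1) \<delta>" and seq: "eigenvalue_sequence M d A As \<theta>"
  obtains \<pi> where "bij_betw \<pi> {0..d} {0..d}" "\<forall>i\<le>d. \<theta> i = \<delta> (\<pi> i)"
    "irreducible_tridiagonal d (\<lambda>i j. \<psi> As $$ (\<pi> i, \<pi> j))" "inj_on \<delta> {0..d}"
proof -
  have seq': "eigenvalue_sequence (mat_algebra d) d (mat_diag (d + 1) \<delta>) (\<psi> As) \<theta>"
    using eigenvalue_sequence_transport[OF M assoc_algebra_mat \<psi> A] diag seq by simp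
  then have bij: "bij_betw \<theta> {0..d} (\<delta> ` {0..d})"
    by (simp only: eigenvalue_sequence_iff eigenvalues_in_mat_diag)
  \<comment> \<open>The \<open>d + 1\<close> distinct values of \<theta> are exactly the values of
    \<delta>, so \<delta> cannot repeat one.\<close>
  then have "card (\<delta> ` {0..d}) = card {0..d}"
    by (simp only: bij_betw_same_card)
  then have inj: "inj_on \<delta> {0..d}"
    by (intro eq_card_imp_inj_on) auto
  define \<pi> where "\<pi> = inv_into {0..d} \<delta> \<circ> \<theta>"
  have \<pi>: "bij_betw \<pi> {0..d} {0..d}"
    unfolding \<pi>_def
    by (rule bij_betw_trans[OF bij bij_betw_inv_into[OF inj_on_imp_bij_betw[OF inj]]])
  have \<theta>: "\<theta> i = \<delta> (\<pi> i)" if "i \<le> d" for i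
    unfolding \<pi>_def o_def using bij that by (intro f_inv_into_f[symmetric]) (auto simp: bij_betw_def)
  have X: "\<psi> As \<in> carrier_mat (d + 1) (d + 1)"
    using algebra_iso_closed[OF \<psi> A(2)] by (simp only: module_mat_simps)
  show ?thesis
    using that[OF \<pi> _ _ inj] \<theta> seq' eigenvalue_sequence_mat_diag[OF X inj \<pi> \<theta>] by blast
qed

lemma eigenvalue_sequence_iff_irreducible:
  fixes M :: "('k::field, 'a) module"
  assumes M: "assoc_algebra M" and \<psi>: "\<psi> \<in> algebra_iso M (mat_algebra d)"
    and A: "A \<in> carrier M" "As \<in> carrier M"
    and diag: "\<psi> A = mat_diag (d + 1) \<delta>" and inj: "inj_on \<delta> {0..d}"
    and \<pi>: "bij_betw \<pi> {0..d} {0..d}" and \<theta>: "\<And>i. i \<le> d \<Longrightarrow> \<theta> i = \<delta> (\<pi> i)"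
  shows "eigenvalue_sequence M d A As \<theta> \<longleftrightarrow> irreducible_tridiagonal d (\<lambda>i j. \<psi> As $$ (\<pi> i, \<pi> j))"
proof -
  have X: "\<psi> As \<in> carrier_mat (d + 1) (d + 1)"
    using algebra_iso_closed[OF \<psi> A(2)] by (simp only: module_mat_simps)
  show ?thesis
    using eigenvalue_sequence_transport[OF M assoc_algebra_mat \<psi> A] diag
      eigenvalue_sequence_mat_diag[OF X inj \<pi> \<theta>] by simp
qed

lemma bij_betw_reverse: "bij_betw (\<lambda>i. d - i) {0..d} {0..d::nat}"
  by (intro bij_betw_byWitness[where f' = "\<lambda>i. d - i"]) auto

text \<open>With \<open>\<psi> A\<close> diagonal, eigenvalue sequences correspond to the orderings
  of the diagonal that make \<open>\<psi> As\<close> irreducible tridiagonal; only the given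
  ordering and its reversal qualify.\<close>

lemma eigenvalue_sequence_reverse_unique:
  fixes M :: "('k::field, 'a) module"
  assumes M: "assoc_algebra M" and \<phi>: "\<phi> \<in> algebra_iso M (mat_algebra d)"
    and A: "A \<in> carrier M" "As \<in> carrier M" and \<theta>: "eigenvalue_sequence M d A As \<theta>"
  shows "eigenvalue_sequence M d A As (\<lambda>i. \<theta> (d - i))"
    and "eigenvalue_sequence M d A As \<theta>' \<Longrightarrow>
      (\<forall>i\<le>d. \<theta>' i = \<theta> i) \<or> (\<forall>i\<le>d. \<theta>' i = \<theta> (d - i))"
proof -
  have bij: "bij_betw \<theta> {0..d} (eigenvalues_in M d A)"
    using \<theta> by (simp add: eigenvalue_sequence_iff)
  then have inj: "inj_on \<theta> {0..d}"
    by (simp add: bij_betw_def)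
  obtain \<psi> where \<psi>: "\<psi> \<in> algebra_iso M (mat_algebra d)" "\<psi> A = mat_diag (d + 1) \<theta>"
    by (rule diagonal_representation[OF M \<phi> A(1) bij])
  note iff = eigenvalue_sequence_iff_irreducible[OF M \<psi>(1) A \<psi>(2) inj]
  have irr: "irreducible_tridiagonal d (\<lambda>i j. \<psi> As $$ (i, j))"
    using iff[of "\<lambda>i. i" \<theta>] \<theta> by (simp add: bij_betw_def)
  show "eigenvalue_sequence M d A As (\<lambda>i. \<theta> (d - i))"
    using iff[OF bij_betw_reverse, of "\<lambda>i. \<theta> (d - i)"] irreducible_tridiagonal_reverse[OF irr] by simp
  assume "eigenvalue_sequence M d A As \<theta>'"
  then obtain \<pi> where \<pi>: "bij_betw \<pi> {0..d} {0..d}" "\<forall>i\<le>d. \<theta>' i = \<theta> (\<pi> i)"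
    "irreducible_tridiagonal d (\<lambda>i j. \<psi> As $$ (\<pi> i, \<pi> j))" "inj_on \<theta> {0..d}"
    by (rule eigenvalue_sequence_permutation[OF M \<psi>(1) A \<psi>(2)])
  have "(\<forall>i\<le>d. \<pi> i = i) \<or> (\<forall>i\<le>d. \<pi> i = d - i)"
    using irr
    by (intro irreducible_tridiagonal_permutation[OF \<pi>(1) _ \<pi>(3)]) (simp add: irreducible_tridiagonal_def)
  then show "(\<forall>i\<le>d. \<theta>' i = \<theta> i) \<or> (\<forall>i\<le>d. \<theta>' i = \<theta> (d - i))"
    using \<pi>(2) by auto
qed

text \<open>For \<open>j > 0\<close>, column \<open>j - 1\<close> of the eigenvector equation
  contains \<open>q j\<close> with a nonzero coefficient and otherwise only earlier entries, so a
  zero at the start propagates.\<close>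

lemma irreducible_tridiagonal_left_eigenvector:
  fixes T :: "nat \<Rightarrow> nat \<Rightarrow> 'k::field"
  assumes T: "irreducible_tridiagonal d T"
    and q: "\<And>j. j \<le> d \<Longrightarrow> (\<Sum>k\<le>d. q k * T k j) = c * q j" and q0: "q 0 = 0" and j: "j \<le> d"
  shows "q j = 0"
  using j
proof (induction j rule: less_induct)
  case (less j)
  show ?case
  proof (cases j)
    case 0
    then show ?thesis using q0 by simp
  next
    case (Suc i)
    have small: "q k = 0" if "k \<le> i" for k
      using less.IH[of k] less.prems Suc that by simp
    have "q k * T k i = 0" if "k \<in> {..d} - {j}" for k
    proof (cases "k \<le> i")
      case False
      then have "T k i = 0"
        using that T Suc less.prems by (auto simp: irreducible_tridiagonal_def)
      then show ?thesis by simp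
    qed (use small in simp)
    then have "(\<Sum>k\<le>d. q k * T k i) = q j * T j i"
      using less.prems by (subst sum.remove[of _ j]) (simp_all add: sum.neutral)
    moreover have "(\<Sum>k\<le>d. q k * T k i) = 0"
      using q[of i] small[of i] less.prems Suc by simp
    moreover have "T j i \<noteq> 0"
      using T Suc less.prems by (auto simp: irreducible_tridiagonal_def)
    ultimately show ?thesis by simp
  qed
qed

text \<open>The diagonal and the row sum are prescribed by \<open>\<theta>s\<close> and
  \<open>\<theta> 0\<close>; applying this to reversed sequences as well realizes all
  combinations.\<close>

lemma TDD_canonical_form_exists:
  fixes M :: "('k::field, 'a) module"
  assumes L: "leonard_pair M d A As" and \<theta>: "eigenvalue_sequence M d A As \<theta>"
    and \<theta>s: "eigenvalue_sequence M d As A \<theta>s"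
  obtains B where "(B, mat_diag (d + 1) \<theta>s) \<in> TDD_canonical_forms M A As"
    "\<And>i. i \<le> d \<Longrightarrow> (\<Sum>j\<le>d. B $$ (i, j)) = \<theta> 0"
proof -
  let ?n = "d + 1"
  have M: "assoc_algebra M" and A: "A \<in> carrier M" "As \<in> carrier M"
    using L by (auto simp: leonard_pair_def multiplicity_free_def)
  obtain \<phi> where \<phi>: "\<phi> \<in> algebra_iso M (mat_algebra d)"
    using L by (auto simp: leonard_pair_def)
  have bij: "bij_betw \<theta> {0..d} (eigenvalues_in M d A)" "bij_betw \<theta>s {0..d} (eigenvalues_in M d As)"
    using \<theta> \<theta>s by (simp_all add: eigenvalue_sequence_iff)
  then have inj: "inj_on \<theta> {0..d}" "inj_on \<theta>s {0..d}"
    by (simp_all add: bij_betw_def)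
  obtain \<psi> where \<psi>: "\<psi> \<in> algebra_iso M (mat_algebra d)" "\<psi> As = mat_diag ?n \<theta>s"
    by (rule diagonal_representation[OF M \<phi> A(2) bij(2)])
  define X where "X = \<psi> A"
  have X: "X \<in> carrier_mat ?n ?n"
    unfolding X_def using algebra_iso_closed[OF \<psi>(1) A(1)] by (simp only: module_mat_simps)
  have irrX: "irreducible_tridiagonal d (\<lambda>i j. X $$ (i, j))"
    using eigenvalue_sequence_iff_irreducible[OF M \<psi>(1) A(2,1) \<psi>(2) inj(2), of "\<lambda>i. i" \<theta>s] \<theta>s
    by (simp add: bij_betw_def X_def)
  obtain P Q where P: "P \<in> carrier_mat ?n ?n" and Q: "Q \<in> carrier_mat ?n ?n"
    and PQ: "P * Q = 1\<^sub>m ?n" and XQ: "X * Q = Q * mat_diag ?n \<theta>"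
    and \<chi>: "(\<lambda>X. P * X * Q) \<circ> \<psi> \<in> algebra_iso M (mat_algebra d)" "P * \<psi> A * Q = mat_diag ?n \<theta>"
    unfolding X_def by (rule diagonalizing_iso[OF M \<psi>(1) A(1) bij(1)])
  have QP: "Q * P = 1\<^sub>m ?n"
    using mat_mult_left_right_inverse[OF P Q PQ] .
  \<comment> \<open>\<open>T\<close> represents \<open>As\<close> in the eigenbasis of
    \<open>A\<close>.\<close>
  define T where "T = P * mat_diag ?n \<theta>s * Q"
  have T: "T \<in> carrier_mat ?n ?n"
    unfolding T_def by (rule mult_carrier_mat[OF mult_carrier_mat[OF P mat_diag_dim] Q])
  have irrT: "irreducible_tridiagonal d (\<lambda>i j. T $$ (i, j))"
    using eigenvalue_sequence_iff_irreducible[OF M \<chi>(1) A _ inj(1), of "\<lambda>i. i" \<theta>] \<theta> \<chi>(2) \<psi>(2)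
    by (simp add: bij_betw_def T_def)
  have DQ: "mat_diag ?n \<theta>s * Q \<in> carrier_mat ?n ?n"
    using Q by (rule mult_carrier_mat[OF mat_diag_dim])
  \<comment> \<open>The aim is that row \<open>i\<close> of \<open>Q\<close> is a left eigenvector
    of \<open>T\<close> for \<open>\<theta>s i\<close>.\<close>
  have "Q * T = (Q * P) * (mat_diag ?n \<theta>s * Q)"
    unfolding T_def assoc_mult_mat[OF P mat_diag_dim Q] assoc_mult_mat[OF Q P DQ] ..
  then have QT: "Q * T = mat_diag ?n \<theta>s * Q"
    unfolding QP left_mult_one_mat[OF DQ] .
  have nonzero: "Q $$ (i, 0) \<noteq> 0" if i: "i \<le> d" for i
  proof
    assume q0: "Q $$ (i, 0) = 0"
    have row: "(\<Sum>k\<le>d. Q $$ (i, k) * T $$ (k, j)) = \<theta>s i * Q $$ (i, j)" if j: "j \<le> d" for j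
    proof -
      have "(\<Sum>k\<le>d. Q $$ (i, k) * T $$ (k, j)) = (Q * T) $$ (i, j)"
        using i j by (subst mult_mat_index_sum[OF Q T]) (auto simp: lessThan_Suc_atMost)
      also have "\<dots> = \<theta>s i * Q $$ (i, j)"
        unfolding QT mat_diag_mult_left[OF Q] using i j by simp
      finally show ?thesis .
    qed
    \<comment> \<open>A zero in column \<open>0\<close> would wipe out the whole row, contrary to
      \<open>Q * P\<close> being the identity.\<close>
    have "Q $$ (i, j) = 0" if "j \<le> d" for j
      using row q0 that by (rule irreducible_tridiagonal_left_eigenvector[OF irrT])
    then have "(Q * P) $$ (i, i) = 0"
      using i by (subst mult_mat_index_sum[OF Q P]) (simp_all add: sum.neutral lessThan_Suc_atMost)
    then show False
      using i unfolding QP by simp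
  qed
  \<comment> \<open>An eigenvector of \<open>X\<close> for \<open>\<theta> 0\<close>. Conjugating by
    its entries turns it into the all-ones vector, whose eigenvalue is the row sum.\<close>
  define v where "v i = Q $$ (i, 0)" for i
  define F where "F = mat_diag ?n (\<lambda>i. 1 / v i)"
  define G where "G = mat_diag ?n v"
  have v: "v i \<noteq> 0" if "i \<le> d" for i
    using nonzero that by (simp add: v_def)
  have FG: "F \<in> carrier_mat ?n ?n" "G \<in> carrier_mat ?n ?n" "F * G = 1\<^sub>m ?n"
    using v unfolding F_def G_def mat_diag_diag mat_diag_one[symmetric] mat_diag_eq_iff by auto
  define B where "B = F * X * G"
  have B: "B = Matrix.mat ?n ?n (\<lambda>(i, j). 1 / v i * X $$ (i, j) * v j)"
    unfolding B_def F_def G_def mat_diag_mult_mat_mult_mat_diag[OF X] ..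
  have Bs: "F * mat_diag ?n \<theta>s * G = mat_diag ?n \<theta>s"
    using v unfolding F_def G_def mat_diag_diag mat_diag_eq_iff by auto
  let ?\<kappa> = "(\<lambda>X. F * X * G) \<circ> \<psi>"
  have \<kappa>: "?\<kappa> \<in> algebra_iso M (mat_algebra d)" "?\<kappa> A = B" "?\<kappa> As = mat_diag ?n \<theta>s"
    using algebra_iso_trans[OF \<psi>(1) conjugation_algebra_iso[OF FG]] Bs \<psi>(2) by (simp_all add: B_def X_def)
  have sums: "(\<Sum>j\<le>d. B $$ (i, j)) = \<theta> 0" if i: "i \<le> d" for i
  proof -
    have "(\<Sum>j\<le>d. B $$ (i, j)) = (\<Sum>j\<le>d. X $$ (i, j) * Q $$ (j, 0)) / v i"
      using i unfolding B sum_divide_distrib by (intro sum.cong) (auto simp: v_def)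
    also have "(\<Sum>j\<le>d. X $$ (i, j) * Q $$ (j, 0)) = (X * Q) $$ (i, 0)"
      using i by (subst mult_mat_index_sum[OF X Q]) (auto simp: lessThan_Suc_atMost)
    also have "\<dots> = v i * \<theta> 0"
      unfolding XQ mat_diag_mult_right[OF Q] using i by (simp add: v_def)
    finally show ?thesis
      using v[OF i] by simp
  qed
  have "X $$ (i, j) = 0" if "i \<le> d" "j \<le> d" "\<not> \<bar>int i - int j\<bar> \<le> 1" for i j
    using irrX that by (simp add: irreducible_tridiagonal_def)
  then have "tridiagonal_mat B"
    unfolding tridiagonal_mat_def B by (simp add: less_Suc_eq_le) blast
  moreover have "diagonal_mat (mat_diag ?n \<theta>s)"
    by (simp add: diagonal_mat_def mat_diag_def)
  moreover have "leonard_pair (mat_algebra d) d B (mat_diag ?n \<theta>s)"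
    using leonard_pair_transport[OF assoc_algebra_mat \<kappa>(1) L] unfolding \<kappa> .
  moreover have "eigenvalue_sequence (mat_algebra d) d B (mat_diag ?n \<theta>s) \<theta>"
    using eigenvalue_sequence_transport[OF M assoc_algebra_mat \<kappa>(1) A] \<theta> unfolding \<kappa> by simp
  moreover have "\<exists>s\<in>{\<theta> 0, \<theta> d}. \<forall>i\<le>d. (\<Sum>j\<le>d. B $$ (i, j)) = s"
    using sums by (intro bexI[of _ "\<theta> 0"]) simp_all
  ultimately have "in_TDD_canonical_form d B (mat_diag ?n \<theta>s)"
    unfolding in_TDD_canonical_form_def by (intro conjI exI[of _ \<theta>])
  moreover have "leonard_isomorphic M A As (mat_algebra d) B (mat_diag ?n \<theta>s)"
    unfolding leonard_isomorphic_def using \<kappa> by (intro bexI[OF _ \<kappa>(1)] conjI)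
  ultimately have "(B, mat_diag ?n \<theta>s) \<in> TDD_canonical_forms M A As"
    by (simp add: TDD_canonical_forms_def exI[of _ d])
  then show ?thesis
    using sums by (rule that)
qed

section \<open>Uniqueness of canonical forms\<close>

text \<open>With \<open>e\<close> the diagonal matrix unit at \<open>i\<close>, the product
  \<open>e * Y * e\<close> is the entry of \<open>Y\<close> at \<open>(i, i)\<close> times
  \<open>e\<close>; since \<chi> fixes \<open>e\<close>, comparing images gives the claim.\<close>

lemma automorphism_diagonal_entry:
  fixes Y :: "'k::field mat"
  assumes \<chi>: "\<chi> \<in> algebra_iso (mat_algebra d) (mat_algebra d)"
    and fix_idem: "\<chi> (mat_diag (d + 1) (\<lambda>k. if k = i then 1 else 0)) =
      mat_diag (d + 1) (\<lambda>k. if k = i then 1 else 0)"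
    and Y: "Y \<in> carrier_mat (d + 1) (d + 1)" and i: "i \<le> d"
  shows "\<chi> Y $$ (i, i) = Y $$ (i, i)"
proof -
  let ?n = "d + 1" and ?e = "mat_diag (d + 1) (\<lambda>k. if k = i then 1 else 0 :: 'k)"
  have eYe: "?e * Z * ?e = Z $$ (i, i) \<cdot>\<^sub>m ?e" if Z: "Z \<in> carrier_mat ?n ?n" for Z
    unfolding mat_diag_mult_mat_mult_mat_diag[OF Z] using i by (intro eq_matI) (auto simp: mat_diag_def)
  have mult: "\<chi> (Z * W) = \<chi> Z * \<chi> W" if "Z \<in> carrier_mat ?n ?n" "W \<in> carrier_mat ?n ?n" for Z W
    using algebra_iso_mult[OF \<chi>, of Z W] that by (simp only: module_mat_simps)
  have \<chi>Y: "\<chi> Y \<in> carrier_mat ?n ?n"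
    using algebra_iso_closed[OF \<chi>, of Y] Y by (simp only: module_mat_simps)
  have "\<chi> Y $$ (i, i) \<cdot>\<^sub>m ?e = \<chi> ?e * \<chi> Y * \<chi> ?e"
    unfolding fix_idem by (rule eYe[OF \<chi>Y, symmetric])
  also have "\<dots> = \<chi> (?e * Y * ?e)"
    unfolding mult[OF mult_carrier_mat[OF mat_diag_dim Y] mat_diag_dim] mult[OF mat_diag_dim Y] ..
  also have "\<dots> = Y $$ (i, i) \<cdot>\<^sub>m \<chi> ?e"
    unfolding eYe[OF Y] using algebra_iso_smult[OF \<chi>, of ?e] by (simp add: module_mat_simps)
  finally have "(\<chi> Y $$ (i, i) \<cdot>\<^sub>m ?e) $$ (i, i) = (Y $$ (i, i) \<cdot>\<^sub>m ?e) $$ (i, i)"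
    unfolding fix_idem by simp
  then show ?thesis
    using i by (simp add: mat_diag_def)
qed

text \<open>For \<open>k = i\<close> this exhibits the product of opposite entries as a diagonal
  entry, to which \<open>automorphism_diagonal_entry\<close> applies.\<close>

lemma mat_mult_unit_idempotent_mult:
  fixes X :: "'k::field mat"
  assumes X: "X \<in> carrier_mat n n" and ijk: "i < n" "j < n" "k < n"
  shows "(X * mat_diag n (\<lambda>k. if k = j then 1 else 0) * X) $$ (i, k) = X $$ (i, j) * X $$ (j, k)"
proof -
  let ?e = "mat_diag n (\<lambda>k. if k = j then 1 else 0)"
  have "(X * ?e * X) $$ (i, k) = (\<Sum>l<n. (X * ?e) $$ (i, l) * X $$ (l, k))"
    using ijk by (intro mult_mat_index_sum[OF mult_carrier_mat[OF X mat_diag_dim] X])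
  also have "\<dots> = (\<Sum>l<n. if l = j then X $$ (i, j) * X $$ (j, k) else 0)"
    unfolding mat_diag_mult_right[OF X] using ijk by (intro sum.cong) auto
  finally show ?thesis
    using ijk by simp
qed

text \<open>The diagonal and the products \<open>X i j * X j i\<close> are automorphism invariant; going down the rows,
  the row sum then fixes the superdiagonal entry and the product fixes the next subdiagonal one.\<close>

lemma TDD_form_unique:
  fixes X X' :: "'k::field mat"
  assumes \<chi>: "\<chi> \<in> algebra_iso (mat_algebra d) (mat_algebra d)"
    and D: "\<chi> (mat_diag (d + 1) \<delta>) = mat_diag (d + 1) \<delta>" and inj: "inj_on \<delta> {0..d}"
    and X: "X \<in> carrier_mat (d + 1) (d + 1)" and \<chi>X: "\<chi> X = X'"
    and irr: "irreducible_tridiagonal d (\<lambda>i j. X $$ (i, j))"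
      "irreducible_tridiagonal d (\<lambda>i j. X' $$ (i, j))"
    and sums: "\<And>i. i \<le> d \<Longrightarrow> (\<Sum>j\<le>d. X $$ (i, j)) = s" "\<And>i. i \<le> d \<Longrightarrow> (\<Sum>j\<le>d. X' $$ (i, j)) = s"
  shows "X = X'"
proof -
  let ?n = "d + 1" and ?e = "\<lambda>i. mat_diag (d + 1) (\<lambda>k. if k = i then 1 else 0 :: 'k)"
  have X': "X' \<in> carrier_mat ?n ?n"
    using algebra_iso_closed[OF \<chi>, of X] X \<chi>X by (simp only: module_mat_simps)
  have e: "primitive_idempotent (mat_algebra d) d (mat_diag ?n \<delta>) \<delta> i = ?e i" if "i \<le> d" for i
    using inj that
    by (subst primitive_idempotent_mat_diag) (auto simp: mat_diag_eq_iff inj_on_def)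
  \<comment> \<open>The matrix unit is a primitive idempotent of the diagonal matrix, hence a
    polynomial in it, and \<chi> fixes that matrix.\<close>
  have fix_e: "\<chi> (?e i) = ?e i" if "i \<le> d" for i
    using primitive_idempotent_transport[OF assoc_algebra_mat assoc_algebra_mat \<chi>, of "mat_diag ?n \<delta>" d \<delta> i] D
    unfolding e[OF that] by (simp add: e[OF that, simplified] module_mat_simps)
  have mult: "\<chi> (Z * W) = \<chi> Z * \<chi> W" if "Z \<in> carrier_mat ?n ?n" "W \<in> carrier_mat ?n ?n" for Z W
    using algebra_iso_mult[OF \<chi>, of Z W] that by (simp only: module_mat_simps)
  have diag: "X $$ (i, i) = X' $$ (i, i)" if "i \<le> d" for i
    using automorphism_diagonal_entry[OF \<chi> fix_e[OF that] X that] \<chi>X by simp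
  have prods: "X $$ (i, j) * X $$ (j, i) = X' $$ (i, j) * X' $$ (j, i)" if ij: "i \<le> d" "j \<le> d" for i j
  proof -
    have Xe: "X * ?e j \<in> carrier_mat ?n ?n"
      by (rule mult_carrier_mat[OF X mat_diag_dim])
    have "\<chi> (X * ?e j * X) = X' * ?e j * X'"
      unfolding mult[OF Xe X] mult[OF X mat_diag_dim] \<chi>X fix_e[OF ij(2)] ..
    then have "(X * ?e j * X) $$ (i, i) = (X' * ?e j * X') $$ (i, i)"
      using automorphism_diagonal_entry[OF \<chi> fix_e[OF ij(1)] mult_carrier_mat[OF Xe X] ij(1)] by simp
    then show ?thesis
      using ij mat_mult_unit_idempotent_mult[OF X, of i j i] mat_mult_unit_idempotent_mult[OF X', of i j i]
      by simp
  qed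
  have row: "\<forall>j\<le>d. X $$ (i, j) = X' $$ (i, j)" if "i \<le> d" for i
    using that
  proof (induction i rule: less_induct)
    case (less i)
    have off: "X $$ (i, j) = X' $$ (i, j)" if j: "j \<le> d" "j \<noteq> i + 1" for j
    proof -
      consider "j = i" | "i = j + 1" | "\<bar>int i - int j\<bar> > 1"
        using j(2) by linarith
      then show ?thesis
      proof cases
        case 1
        then show ?thesis using diag less.prems by simp
      next
        \<comment> \<open>The opposite entry lies on the superdiagonal in the preceding row, so it
          is already known; being nonzero, it cancels from the product.\<close>
        case 2
        then have "X $$ (j, i) = X' $$ (j, i)"
          using less.IH[of j] less.prems j by simp
        moreover have "X' $$ (j, i) \<noteq> 0"
          using irr(2) 2 less.prems j by (simp add: irreducible_tridiagonal_def)
        ultimately show ?thesis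
          using prods[OF less.prems j(1)] by simp
      next
        case 3
        then show ?thesis
          using irr less.prems j(1) by (simp add: irreducible_tridiagonal_def)
      qed
    qed
    \<comment> \<open>The superdiagonal entry is the only unknown left in the row sum.\<close>
    have "X $$ (i, i + 1) = X' $$ (i, i + 1)" if "i + 1 \<le> d"
    proof -
      have "(\<Sum>j\<in>{..d} - {i + 1}. X $$ (i, j)) = (\<Sum>j\<in>{..d} - {i + 1}. X' $$ (i, j))"
        using off by (intro sum.cong) auto
      moreover have "(\<Sum>j\<le>d. X $$ (i, j)) = X $$ (i, i + 1) + (\<Sum>j\<in>{..d} - {i + 1}. X $$ (i, j))"
        "(\<Sum>j\<le>d. X' $$ (i, j)) = X' $$ (i, i + 1) + (\<Sum>j\<in>{..d} - {i + 1}. X' $$ (i, j))"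
        using that by (simp_all only: sum.remove[of "{..d}" "i + 1"] finite_atMost atMost_iff)
      ultimately show ?thesis
        using sums[OF less.prems] by simp
    qed
    then show ?case
      using off by blast
  qed
  show ?thesis
    using X X' row by (intro eq_matI) auto
qed

text \<open>Expresses membership through one fixed choice of \<open>\<theta>\<close> and
  \<open>\<theta>s\<close>, with the diameter identified as \<open>d\<close>, so that different
  forms can be compared.\<close>

lemma TDD_canonical_formsE:
  fixes M :: "('k::field, 'a) module"
  assumes L: "leonard_pair M d A As" and \<theta>: "eigenvalue_sequence M d A As \<theta>"
    and \<theta>s: "eigenvalue_sequence M d As A \<theta>s"
    and mem: "(B, Bs) \<in> TDD_canonical_forms M A As"
  obtains \<phi> \<delta> where "\<phi> \<in> algebra_iso M (mat_algebra d)" "\<phi> A = B" "\<phi> As = Bs"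
    "Bs = mat_diag (d + 1) \<delta>" "inj_on \<delta> {0..d}"
    "Bs \<in> {mat_diag (d + 1) \<theta>s, mat_diag (d + 1) (\<lambda>i. \<theta>s (d - i))}"
    "irreducible_tridiagonal d (\<lambda>i j. B $$ (i, j))"
    "\<exists>s\<in>{\<theta> 0, \<theta> d}. \<forall>i\<le>d. (\<Sum>j\<le>d. B $$ (i, j)) = s"
proof -
  have M: "assoc_algebra M" and A: "A \<in> carrier M" "As \<in> carrier M"
    using L by (auto simp: leonard_pair_def multiplicity_free_def)
  obtain d' where d': "in_TDD_canonical_form d' B Bs" "leonard_isomorphic M A As (mat_algebra d') B Bs"
    using mem by (auto simp: TDD_canonical_forms_def)
  obtain \<phi>' where \<phi>': "\<phi>' \<in> algebra_iso M (mat_algebra d')" "\<phi>' A = B" "\<phi>' As = Bs"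
    using d'(2) by (auto simp: leonard_isomorphic_def)
  \<comment> \<open>Pulling the form back along the inverse of \<open>\<phi>'\<close> gives the
    original pair the diameter \<open>d'\<close>.\<close>
  have "leonard_pair M d' A As"
  proof -
    have "leonard_pair (mat_algebra d') d' B Bs"
      using d'(1) by (simp only: in_TDD_canonical_form_def)
    from leonard_pair_transport[OF M algebra_iso_sym[OF M \<phi>'(1)] this] show ?thesis
      unfolding \<phi>'(2,3)[symmetric] algebra_iso_inv_apply[OF \<phi>'(1) A(1)] algebra_iso_inv_apply[OF \<phi>'(1) A(2)] .
  qed
  then have "d' = d"
    using diameter_unique[OF L] by blast
  note d = d'(1)[unfolded this] and \<phi> = \<phi>'[unfolded this]
  have tri: "tridiagonal_mat B" and dia: "diagonal_mat Bs"
    using d by (simp_all only: in_TDD_canonical_form_def)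
  have B: "B \<in> carrier_mat (d + 1) (d + 1)" "Bs \<in> carrier_mat (d + 1) (d + 1)"
    using algebra_iso_closed[OF \<phi>(1) A(1)] algebra_iso_closed[OF \<phi>(1) A(2)] \<phi>(2,3)
    by (simp_all only: module_mat_simps)
  define \<delta> where "\<delta> i = Bs $$ (i, i)" for i
  have \<delta>: "Bs = mat_diag (d + 1) \<delta>"
    using B dia by (intro eq_matI) (auto simp: mat_diag_def \<delta>_def diagonal_mat_def)
  then have \<phi>As: "\<phi>' As = mat_diag (d + 1) \<delta>"
    using \<phi> by simp
  \<comment> \<open>\<open>\<pi>\<close> locates the values of \<open>\<theta>s\<close> on the
    diagonal of \<open>Bs\<close>; tridiagonality of \<open>B\<close> will leave only the identity
    and the reversal.\<close>
  obtain \<pi> where \<pi>: "bij_betw \<pi> {0..d} {0..d}" "\<forall>i\<le>d. \<theta>s i = \<delta> (\<pi> i)"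
    "irreducible_tridiagonal d (\<lambda>i j. \<phi>' A $$ (\<pi> i, \<pi> j))" and inj: "inj_on \<delta> {0..d}"
    by (rule eigenvalue_sequence_permutation[OF M \<phi>(1) A(2,1) \<phi>As \<theta>s])
  have "B $$ (i, j) = 0" if "i \<le> d" "j \<le> d" "\<bar>int i - int j\<bar> > 1" for i j
    using tri[unfolded tridiagonal_mat_def, rule_format, of i j] that B(1) by auto
  then have \<pi>_cases: "(\<forall>i\<le>d. \<pi> i = i) \<or> (\<forall>i\<le>d. \<pi> i = d - i)"
    using irreducible_tridiagonal_permutation[OF \<pi>(1) _ \<pi>(3)] \<phi>(2) by blast
  have irr: "irreducible_tridiagonal d (\<lambda>i j. B $$ (i, j))"
  proof (cases "\<forall>i\<le>d. \<pi> i = i")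
    case True
    then show ?thesis using \<pi>(3) by (simp add: \<phi>(2) irreducible_tridiagonal_def)
  next
    case False
    then have "irreducible_tridiagonal d (\<lambda>i j. B $$ (d - i, d - j))"
      using \<pi>_cases \<pi>(3) by (auto simp: \<phi>(2) irreducible_tridiagonal_def)
    \<comment> \<open>Reversal is an involution on the indices up to \<open>d\<close>, so reversing
      again restores \<open>B\<close>.\<close>
    from irreducible_tridiagonal_reverse[OF this] show ?thesis
      by (simp add: irreducible_tridiagonal_def)
  qed
  have Bs: "Bs \<in> {mat_diag (d + 1) \<theta>s, mat_diag (d + 1) (\<lambda>i. \<theta>s (d - i))}"
    using \<pi>_cases \<pi>(2) by (auto simp: \<delta> mat_diag_eq_iff less_Suc_eq_le)
  obtain \<theta>' s where \<theta>': "eigenvalue_sequence (mat_algebra d) d B Bs \<theta>'" "s \<in> {\<theta>' 0, \<theta>' d}"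
    "\<forall>i\<le>d. (\<Sum>j\<le>d. B $$ (i, j)) = s"
    using d unfolding in_TDD_canonical_form_def by blast
  have "eigenvalue_sequence M d A As \<theta>'"
    using eigenvalue_sequence_transport[OF M assoc_algebra_mat \<phi>(1) A] \<theta>'(1) \<phi>(2,3) by simp
  \<comment> \<open>\<open>\<theta>'\<close> agrees with \<open>\<theta>\<close> up to reversal, and
    reversal preserves the pair of end values.\<close>
  from eigenvalue_sequence_reverse_unique(2)[OF M \<phi>(1) A \<theta> this] have "s \<in> {\<theta> 0, \<theta> d}"
    using \<theta>'(2) by auto
  then show ?thesis
    using that[OF \<phi> \<delta> inj Bs irr] \<theta>'(3) by blast
qed

section \<open>Counting the canonical forms\<close>

theorem corollary22p9:
  fixes M :: "('k::field, 'a) module" and d :: nat and A As :: 'a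
  assumes "leonard_pair M d A As"
  shows "(d \<ge> 1 \<longrightarrow> card (TDD_canonical_forms M A As) = 4) \<and>
    (d = 0 \<longrightarrow> (\<exists>!P. P \<in> TDD_canonical_forms M A As))"
proof -
  let ?S = "TDD_canonical_forms M A As"
  have M: "assoc_algebra M" and A: "A \<in> carrier M" "As \<in> carrier M"
    using assms by (auto simp: leonard_pair_def multiplicity_free_def)
  obtain \<phi>0 where \<phi>0: "\<phi>0 \<in> algebra_iso M (mat_algebra d)"
    using assms by (auto simp: leonard_pair_def)
  obtain \<theta> \<theta>s where \<theta>: "eigenvalue_sequence M d A As \<theta>" and \<theta>s: "eigenvalue_sequence M d As A \<theta>s"
    using assms by (auto simp: leonard_pair_iff)
  define Ds where "Ds = {mat_diag (d + 1) \<theta>s, mat_diag (d + 1) (\<lambda>i. \<theta>s (d - i))}"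
  \<comment> \<open>Diagonal matrix and row sum classify the forms; row \<open>0\<close> suffices,
    as all rows of a form have the same sum.\<close>
  define key where "key P = (snd P, \<Sum>j\<le>d. fst P $$ (0, j))" for P :: "'k mat \<times> 'k mat"
  have "inj_on key ?S"
  proof (rule inj_onI)
    fix P P' assume P: "P \<in> ?S" "P' \<in> ?S" and eq: "key P = key P'"
    obtain B Bs B' where PP: "P = (B, Bs)" "P' = (B', Bs)"
      using eq by (cases P; cases P') (auto simp: key_def)
    obtain \<phi> \<delta> where \<phi>: "\<phi> \<in> algebra_iso M (mat_algebra d)" "\<phi> A = B" "\<phi> As = Bs"
      and \<delta>: "Bs = mat_diag (d + 1) \<delta>" "inj_on \<delta> {0..d}"
      and irr: "irreducible_tridiagonal d (\<lambda>i j. B $$ (i, j))"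
      and s: "\<exists>s\<in>{\<theta> 0, \<theta> d}. \<forall>i\<le>d. (\<Sum>j\<le>d. B $$ (i, j)) = s"
      using P(1) unfolding PP by (rule TDD_canonical_formsE[OF assms \<theta> \<theta>s])
    obtain \<phi>' \<delta>' where \<phi>': "\<phi>' \<in> algebra_iso M (mat_algebra d)" "\<phi>' A = B'" "\<phi>' As = Bs"
      and "Bs = mat_diag (d + 1) \<delta>'" "inj_on \<delta>' {0..d}"
      and irr': "irreducible_tridiagonal d (\<lambda>i j. B' $$ (i, j))"
      and s': "\<exists>s\<in>{\<theta> 0, \<theta> d}. \<forall>i\<le>d. (\<Sum>j\<le>d. B' $$ (i, j)) = s"
      using P(2) unfolding PP by (rule TDD_canonical_formsE[OF assms \<theta> \<theta>s])
    obtain t t' where t: "\<And>i. i \<le> d \<Longrightarrow> (\<Sum>j\<le>d. B $$ (i, j)) = t"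
      and t': "\<And>i. i \<le> d \<Longrightarrow> (\<Sum>j\<le>d. B' $$ (i, j)) = t'"
      using s s' by blast
    have "t = t'"
      using eq t[of 0] t'[of 0] by (simp add: key_def PP)
    \<comment> \<open>An automorphism of the matrix algebra that carries one form to the other and
      fixes their common diagonal matrix.\<close>
    let ?\<chi> = "\<phi>' \<circ> inv_into (carrier M) \<phi>"
    have \<chi>: "?\<chi> \<in> algebra_iso (mat_algebra d) (mat_algebra d)"
      by (rule algebra_iso_trans[OF algebra_iso_sym[OF M \<phi>(1)] \<phi>'(1)])
    have "?\<chi> (\<phi> A) = B'" "?\<chi> (\<phi> As) = Bs"
      using \<phi>'(2,3) by (simp_all add: algebra_iso_inv_apply[OF \<phi>(1)] A)
    then have \<chi>B: "?\<chi> B = B'" and \<chi>Bs: "?\<chi> (mat_diag (d + 1) \<delta>) = mat_diag (d + 1) \<delta>"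
      unfolding \<phi>(2,3) \<delta>(1) .
    have B: "B \<in> carrier_mat (d + 1) (d + 1)"
      using algebra_iso_closed[OF \<phi>(1) A(1)] unfolding \<phi>(2) by (simp only: module_mat_simps)
    have "B = B'"
      using TDD_form_unique[OF \<chi> \<chi>Bs \<delta>(2) B \<chi>B irr irr' t t'[folded \<open>t = t'\<close>]] .
    then show "P = P'"
      by (simp add: PP)
  qed
  moreover have "key ` ?S = Ds \<times> {\<theta> 0, \<theta> d}"
  proof (intro equalityI subsetI)
    fix p assume "p \<in> key ` ?S"
    then obtain B Bs where B: "(B, Bs) \<in> ?S" "p = key (B, Bs)"
      by auto
    have "Bs \<in> Ds" "\<exists>s\<in>{\<theta> 0, \<theta> d}. \<forall>i\<le>d. (\<Sum>j\<le>d. B $$ (i, j)) = s"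
      unfolding Ds_def by (rule TDD_canonical_formsE[OF assms \<theta> \<theta>s B(1)], assumption)+
    then show "p \<in> Ds \<times> {\<theta> 0, \<theta> d}"
      unfolding B(2) key_def by auto
  next
    fix p assume "p \<in> Ds \<times> {\<theta> 0, \<theta> d}"
    then obtain D s where p: "p = (D, s)" "D \<in> Ds" "s \<in> {\<theta> 0, \<theta> d}"
      by auto
    \<comment> \<open>The prescribed row sum selects \<open>\<theta>\<close> or its reversal;
      likewise \<open>D\<close> selects \<open>\<theta>s\<close> or its reversal below.\<close>
    obtain \<eta> where \<eta>: "eigenvalue_sequence M d A As \<eta>" "\<eta> 0 = s"
      using p(3) \<theta> eigenvalue_sequence_reverse_unique(1)[OF M \<phi>0 A \<theta>] by fastforce
    obtain \<eta>s where \<eta>s: "eigenvalue_sequence M d As A \<eta>s" "D = mat_diag (d + 1) \<eta>s"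
      using p(2) \<theta>s eigenvalue_sequence_reverse_unique(1)[OF M \<phi>0 A(2,1) \<theta>s] unfolding Ds_def by blast
    obtain B where B: "(B, mat_diag (d + 1) \<eta>s) \<in> ?S" "\<And>i. i \<le> d \<Longrightarrow> (\<Sum>j\<le>d. B $$ (i, j)) = \<eta> 0"
      using TDD_canonical_form_exists[OF assms \<eta>(1) \<eta>s(1)] by blast
    have "key (B, mat_diag (d + 1) \<eta>s) = p"
      using B(2)[of 0] by (simp add: key_def p(1) \<eta>(2) \<eta>s(2))
    with B(1) show "p \<in> key ` ?S"
      by blast
  qed
  ultimately have "card ?S = card (Ds \<times> {\<theta> 0, \<theta> d})"
    by (metis card_image)
  then have card: "card ?S = card Ds * card {\<theta> 0, \<theta> d}"
    by (simp only: card_cartesian_product)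
  show ?thesis
  proof (intro conjI impI)
    assume d: "d \<ge> 1"
    have "inj_on \<theta> {0..d}" "inj_on \<theta>s {0..d}"
      using \<theta> \<theta>s by (simp_all add: eigenvalue_sequence_iff bij_betw_def)
    then have ne: "\<theta> 0 \<noteq> \<theta> d" "\<theta>s 0 \<noteq> \<theta>s d"
      using d inj_onD[of \<theta> "{0..d}" 0 d] inj_onD[of \<theta>s "{0..d}" 0 d] by auto
    then have "mat_diag (d + 1) \<theta>s \<noteq> mat_diag (d + 1) (\<lambda>i. \<theta>s (d - i))"
      unfolding mat_diag_eq_iff by (auto intro!: exI[of _ 0])
    then show "card ?S = 4"
      using ne(1) by (simp add: card Ds_def)
  next
    \<comment> \<open>Reversal is trivial here, so both factors of the count are singletons.\<close>
    assume "d = 0"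
    then have "mat_diag (d + 1) (\<lambda>i. \<theta>s (d - i)) = mat_diag (d + 1) \<theta>s"
      by (simp only: mat_diag_eq_iff) simp
    then have "card ?S = 1"
      unfolding card Ds_def by (simp only:) (simp add: \<open>d = 0\<close>)
    then obtain P where "?S = {P}"
      by (rule card_1_singletonE)
    then show "\<exists>!P. P \<in> ?S"
      by simp
  qed
qed

end
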